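(* Let $q\ge 2$ be an integer, let $\sigma$ be a permutation of $\{0,1,\dots,q-1\}$ with $\sigma^{q}=\mathrm{id}$, and let $\mathbf r=(r_0,\dots,r_{q-2})$ be an admissible vector (see context), $r_{q-1}=1-\sum_{j=0}^{q-2}r_j$. Then for every $x\in I=[0,1]$: (i) If $\mathbf u=\mathbf e_l$ for some $0\le l\le q-2$, then \[ \frac{1}{q}\frac{\partial}{\partial r_{l}}L_{\mathbf r}(x) =(\mathbf 1_{I_{1}(l)}(x)-\mathbf 1_{I_{1}(q-1)}(x))(L_{\mathbf q,\mathbf r}(x)-x) +\Big(\sum_{n=0}^{q-1}r_{n}\mathbf 1_{I_{1}(n)}(x)\Big)\, q\,\mathcal T_{\mathbf q,\mathbf r,\mathbf e_{l}}(x) +\int_{0}^{x}(\mathbf 1_{I_{1}(l)}-\mathbf 1_{I_{1}(q-1)})\,d\mu . \] (ii) If $\mathbf u=(u_0,\dots,u_{q-2})$ is a multi-index with $|\mathbf u|\ge 2$, then \[ \frac{1}{q\,\mathbf u!}\frac{\partial^{u_0+\cdots+u_{q-2}}}{\partial r_0^{u_0}\cdots\partial r_{q-2}^{u_{q-2}}}L_{\mathbf r}(x) =\sum_{\substack{j=0\\ u_j>0}}^{q-2}(\mathbf 1_{I_{1}(j)}(x)-\mathbf 1_{I_{1}(q-1)}(x))\,q\,\mathcal T_{\mathbf q,\mathbf r,\mathbf u-\mathbf e_j}(x) +\Big(\sum_{n=0}^{q-1}r_{n}\mathbf 1_{I_{1}(n)}(x)\Big)\,q\,\mathcal T_{\mathbf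 q,\mathbf r,\mathbf u}(x). \]
   Context: Let $I=[0,1]$, $I_0(0)=I$, and for $k\ge1$: $I_k(n)=[n/q^k,(n+1)/q^k)$ for $0\le n\le q^k-2$ and $I_k(q^k-1)=[(q^k-1)/q^k,1]$. Let $\mathcal F_k$ be the $\sigma$-field generated by $\{I_k(n):0\le n\le q^k-1\}$, $\mathcal F=\bigvee_{k\ge0}\mathcal F_k$. A vector $\mathbf d=(d_0,\dots,d_{q-2})$ is admissible if $0<d_j<1$ for all $j$ and $0<\sum_{j=0}^{q-2}d_j<1$; then set $d_{q-1}=1-\sum_{j=0}^{q-2}d_j$. For admissible $\mathbf d,\mathbf r$, $\mu_{\mathbf d,\mathbf r}$ is the probability measure on $(I,\mathcal F)$ with $\mu_{\mathbf d,\mathbf r}(I)=1$, $\mu_{\mathbf d,\mathbf r}(I_1(n))=d_n$ ($0\le n\le q-1$), and for $k\ge2$, $\mu_{\mathbf d,\mathbf r}(I_k(n))=\mu_{\mathbf d,\mathbf r}(I_{k-1}(j))\,r_{\sigma^j(l)}$ where $n=qj+l$, $0\le l\le q-1$. $L_{\mathbf d,\mathbf r}(x)=\mu_{\mathbf d,\mathbf r}([0,x])$ and $L_{\mathbf r}=L_{\mathbf r,\mathbf r}$ (a function of $x$ and of $r_0,\dots,r_{q-2}$). $\mathbf q=(1/q,\dots,1/q)$ ($q-1$ entries). For $n\ge0$, $\mathbf r_{\sigma^n}=(r_{\sigma^n(0)},\dots,r_{\sigma^n(q-2)})$. $\mu$ is Lebesgue measure on $I$, and $\int_0^x f\,d\nu$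 means $\int_{[0,x]}f\,d\nu$. $\mathbf 1_S$ is the indicator of $S$. Multi-indices: $\mathbf u=(u_0,\dots,u_{q-2})$ with $u_l\in\mathbb N\cup\{0\}$, $|\mathbf u|=\sum_l u_l$, $\mathbf u!=\prod_l u_l!$, and $\mathbf e_l$ ($0\le l\le q-2$) is the multi-index with $1$ in position $l$ and $0$ elsewhere. $\phi:I\to I$ is $\phi(x)=qx \bmod 1\in[0,1)$ for $x\in[0,1)$, $\phi(1)=1$; $\phi^j$ is its $j$-th iterate ($\phi^0=\mathrm{id}$). For $0\le l\le q-1$, $\Phi_l=\sum_{j=0}^{q-1}\mathbf 1_{I_2(qj+\sigma^{-j}(l))}$. The generalized Takagi function $\mathcal T_{\mathbf d,\mathbf r,\mathbf u}$ (for admissible $\mathbf d,\mathbf r$ and $|\mathbf u|\ge1$) is defined recursively: (i) $\mathcal T_{\mathbf d,\mathbf r,\mathbf e_l}(x)=\frac1q\sum_{j=0}^{\infty}\sum_{n=0}^{q^j-1}\mu_{\mathbf d,\mathbf r}(I_j(n))\mathbf 1_{I_j(n)}(x)\int_0^{\phi^j(x)}\big(\frac{\Phi_l}{r_l}-\frac{\Phi_{q-1}}{r_{q-1}}\big)d\mu_{\mathbf r_{\sigma^n},\mathbf r}$; (ii) for $|\mathbf u|\ge2$, $\mathcal T_{\mathbf d,\mathbf r,\mathbf u}(x)=\sum_{j=0}^{\infty}\sum_{\alpha=0,\,u_\alpha>0}^{q-2}\Big(\big(\frac{\Phi_\alpha}{r_\alpha}-\frac{\Phi_{q-1}}{r_{q-1}}\big)\circ\phi^j(x)\Big)\sum_{n=0}^{q^{j+1}-1}\mu_{\mathbf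 d,\mathbf r}(I_{j+1}(n))\mathbf 1_{I_{j+1}(n)}(x)\big(\mathcal T_{\mathbf r_{\sigma^n},\mathbf r,\mathbf u-\mathbf e_\alpha}\circ\phi^{j+1}(x)\big)$.
   Formalization: In the definition of T_{d,r,e_l}, the j=0 term is integrated against μ_{d,r} instead of μ_{r,r}; as printed the formula fails, e.g. q=2, σ=id, x=1/4: left side of (i) is r_0, right side r_0/2+r_0². *)

theory Defs
  imports "HOL-Probability.Probability" "HOL-Combinatorics.Permutations"
begin

(* Vectors (d_0, ..., d_{q-2}) and multi-indices (u_0, ..., u_{q-2}) are functions on nat of which
   only the entries below q - 1 matter. *)

definition admissible :: "nat \<Rightarrow> (nat \<Rightarrow> real) \<Rightarrow> bool" where
  "admissible q d \<longleftrightarrow>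
     (\<forall>j<q - 1. 0 < d j \<and> d j < 1) \<and> 0 < (\<Sum>j<q - 1. d j) \<and> (\<Sum>j<q - 1. d j) < 1"

definition completed :: "nat \<Rightarrow> (nat \<Rightarrow> real) \<Rightarrow> nat \<Rightarrow> real" where
  "completed q d j = (if j = q - 1 then 1 - (\<Sum>i<q - 1. d i) else d j)"

definition perm_vec :: "nat \<Rightarrow> (nat \<Rightarrow> nat) \<Rightarrow> nat \<Rightarrow> (nat \<Rightarrow> real) \<Rightarrow> nat \<Rightarrow> real" where
  "perm_vec q \<sigma> n r l = completed q r ((\<sigma> ^^ n) l)"

definition uniform_vec :: "nat \<Rightarrow> nat \<Rightarrow> real" where
  "uniform_vec q l = 1 / real q"

(* Meant for n < q ^ k; for k = 0 it is the whole of [0, 1]. *)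
definition I :: "nat \<Rightarrow> nat \<Rightarrow> nat \<Rightarrow> real set" where
  "I q k n = (if n = q ^ k - 1 then {real n / real q ^ k .. 1}
              else {real n / real q ^ k ..< real (n + 1) / real q ^ k})"

definition level_field :: "nat \<Rightarrow> nat \<Rightarrow> real set set" where
  "level_field q k = sigma_sets {0..1} (I q k ` {..<q ^ k})"

definition full_field :: "nat \<Rightarrow> real set set" where
  "full_field q = sigma_sets {0..1} (\<Union>k. level_field q k)"

definition is_multinomial ::
    "nat \<Rightarrow> (nat \<Rightarrow> nat) \<Rightarrow> (nat \<Rightarrow> real) \<Rightarrow> (nat \<Rightarrow> real) \<Rightarrow> real measure \<Rightarrow> bool" where
  "is_multinomial q \<sigma> d r M \<longleftrightarrow>
     prob_space M \<and> space M = {0..1} \<and> sets M = full_field q \<and>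
     (\<forall>n<q. measure M (I q 1 n) = completed q d n) \<and>
     (\<forall>k\<ge>2. \<forall>j<q ^ (k - 1). \<forall>l<q.
        measure M (I q k (q * j + l)) = measure M (I q (k - 1) j) * completed q r ((\<sigma> ^^ j) l))"

(* For admissible d and r there is exactly one such measure. *)
definition multinomial_measure ::
    "nat \<Rightarrow> (nat \<Rightarrow> nat) \<Rightarrow> (nat \<Rightarrow> real) \<Rightarrow> (nat \<Rightarrow> real) \<Rightarrow> real measure" where
  "multinomial_measure q \<sigma> d r = (THE M. is_multinomial q \<sigma> d r M)"

definition L :: "nat \<Rightarrow> (nat \<Rightarrow> nat) \<Rightarrow> (nat \<Rightarrow> real) \<Rightarrow> (nat \<Rightarrow> real) \<Rightarrow> real \<Rightarrow> real" where
  "L q \<sigma> d r x = measure (multinomial_measure q \<sigma> d r) {0..x}"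

definition shift :: "nat \<Rightarrow> real \<Rightarrow> real" where
  "shift q x = (if x = 1 then 1 else frac (real q * x))"

definition Phi :: "nat \<Rightarrow> (nat \<Rightarrow> nat) \<Rightarrow> nat \<Rightarrow> real \<Rightarrow> real" where
  "Phi q \<sigma> l x = (\<Sum>j<q. indicat_real (I q 2 (q * j + (inv \<sigma> ^^ j) l)) x)"

definition Psi :: "nat \<Rightarrow> (nat \<Rightarrow> nat) \<Rightarrow> (nat \<Rightarrow> real) \<Rightarrow> nat \<Rightarrow> real \<Rightarrow> real" where
  "Psi q \<sigma> r l x = Phi q \<sigma> l x / completed q r l - Phi q \<sigma> (q - 1) x / completed q r (q - 1)"

(* The measure mu_{d,r} conditioned on I_j(n) and rescaled to [0, 1] by the j-th iterate of the
   shift.  For j >= 1 this is the measure with first-level vector r_{sigma^n}; for j = 0 nothing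
   is conditioned and it is mu_{d,r} itself.  Writing r_{sigma^0} = r for d at j = 0 would give a
   different function as soon as d differs from r, and the derivative formulas would then fail:
   for q = 2, sigma = id, x = 1/4 the left side is r_0 and the right side r_0/2 + r_0^2. *)
definition rescaled_measure ::
    "nat \<Rightarrow> (nat \<Rightarrow> nat) \<Rightarrow> (nat \<Rightarrow> real) \<Rightarrow> (nat \<Rightarrow> real) \<Rightarrow> nat \<Rightarrow> nat \<Rightarrow> real measure" where
  "rescaled_measure q \<sigma> d r j n =
     multinomial_measure q \<sigma> (if j = 0 then d else perm_vec q \<sigma> n r) r"

definition takagi_unit ::
    "nat \<Rightarrow> (nat \<Rightarrow> nat) \<Rightarrow> (nat \<Rightarrow> real) \<Rightarrow> (nat \<Rightarrow> real) \<Rightarrow> nat \<Rightarrow> real \<Rightarrow> real" where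
  "takagi_unit q \<sigma> d r l x =
     1 / real q *
     (\<Sum>j. \<Sum>n<q ^ j.
        measure (multinomial_measure q \<sigma> d r) (I q j n) * indicat_real (I q j n) x *
        (LINT t:{0..(shift q ^^ j) x}|rescaled_measure q \<sigma> d r j n. Psi q \<sigma> r l t))"

definition mi_degree :: "nat \<Rightarrow> (nat \<Rightarrow> nat) \<Rightarrow> nat" where
  "mi_degree q u = (\<Sum>l<q - 1. u l)"

definition mi_fact :: "nat \<Rightarrow> (nat \<Rightarrow> nat) \<Rightarrow> nat" where
  "mi_fact q u = (\<Prod>l<q - 1. fact (u l))"

definition mi_unit :: "nat \<Rightarrow> nat \<Rightarrow> nat" where
  "mi_unit l i = (if i = l then 1 else 0)"

definition mi_minus :: "(nat \<Rightarrow> nat) \<Rightarrow> (nat \<Rightarrow> nat) \<Rightarrow> nat \<Rightarrow> nat" where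
  "mi_minus u v i = u i - v i"

lemma mi_degree_minus_unit:
  assumes "a < q - 1" "0 < u a"
  shows "mi_degree q (mi_minus u (mi_unit a)) < mi_degree q u"
  unfolding mi_degree_def
  by (rule sum_strict_mono_ex1) (use assms in \<open>auto simp: mi_minus_def mi_unit_def\<close>)

(* Degree 1 means that u is the unit multi-index at the position where it is 1.
   The value in degree 0 is a dummy. *)
function takagi ::
    "nat \<Rightarrow> (nat \<Rightarrow> nat) \<Rightarrow> (nat \<Rightarrow> real) \<Rightarrow> (nat \<Rightarrow> real) \<Rightarrow> (nat \<Rightarrow> nat) \<Rightarrow> real \<Rightarrow> real" where
  "takagi q \<sigma> d r u x =
     (if mi_degree q u = 0 then 0
      else if mi_degree q u = 1 then takagi_unit q \<sigma> d r (THE l. l < q - 1 \<and> u l = 1) x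
      else (\<Sum>j. \<Sum>a\<in>{a. a < q - 1 \<and> 0 < u a}.
              Psi q \<sigma> r a ((shift q ^^ j) x) *
              (\<Sum>n<q ^ (j + 1).
                 measure (multinomial_measure q \<sigma> d r) (I q (j + 1) n) *
                 indicat_real (I q (j + 1) n) x *
                 takagi q \<sigma> (perm_vec q \<sigma> n r) r (mi_minus u (mi_unit a))
                   ((shift q ^^ (j + 1)) x))))"
  by pat_completeness auto
termination
  by (relation "Wellfounded.measure (\<lambda>(q, \<sigma>, d, r, u, x). mi_degree q u)")
     (auto intro: mi_degree_minus_unit)

declare takagi.simps [simp del]

definition partial_deriv ::
    "nat \<Rightarrow> ((nat \<Rightarrow> real) \<Rightarrow> real) \<Rightarrow> (nat \<Rightarrow> real) \<Rightarrow> real" where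
  "partial_deriv l F r = deriv (\<lambda>t. F (r(l := t))) (r l)"

primrec iterated_partial ::
    "nat list \<Rightarrow> ((nat \<Rightarrow> real) \<Rightarrow> real) \<Rightarrow> (nat \<Rightarrow> real) \<Rightarrow> real" where
  "iterated_partial [] F = F"
| "iterated_partial (l # ls) F = partial_deriv l (iterated_partial ls F)"

(* deriv is total, so the existence of all the derivatives taken along the way is a separate claim. *)
primrec iterated_partial_exists ::
    "(nat \<Rightarrow> real) set \<Rightarrow> nat list \<Rightarrow> ((nat \<Rightarrow> real) \<Rightarrow> real) \<Rightarrow> bool" where
  "iterated_partial_exists A [] F \<longleftrightarrow> True"
| "iterated_partial_exists A (l # ls) F \<longleftrightarrow>
     iterated_partial_exists A ls F \<and>
     (\<forall>r\<in>A. (\<lambda>t. iterated_partial ls F (r(l := t))) field_differentiable (at (r l)))"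

(* [0, ..., 0, 1, ..., 1, ..., q-2, ..., q-2] with l repeated u l times *)
definition mi_list :: "nat \<Rightarrow> (nat \<Rightarrow> nat) \<Rightarrow> nat list" where
  "mi_list q u = concat (map (\<lambda>l. replicate (u l) l) [0..<q - 1])"

end

(* For every state z = (n, y) let H(z; r) be the distribution function at y of the measure whose
   first-level vector is r_{sigma^n}.  Self-similarity of the measure is the affine transfer equation
   H(z) = B(z; r) + w(z; r) H(step z), where step sends (n, y) to (first digit of y, shift of y), B and w
   are affine in r, and 0 <= w <= rho < 1.  Its bounded solution is a geometrically convergent series along
   the orbit of z.  Differentiating formally in r gives, for the Taylor coefficients H_u, the same equation
   with B replaced by a source built from coefficients of lower degree.  That these formal coefficients are
   the true ones needs no termwise differentiation: the error of the difference quotient satisfies the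
   transfer equation with a small source, so it is small uniformly in z.

   The series for H_u is, term by term, the series that defines q T_{d,r,u}(x), divided by d_n, at
   z = (n, shift x) with n the first digit of x.  On the other hand L_r(x) = H((0, x); r), and the asserted
   formulas are a single step of the transfer equation from (0, x).

   The measure itself is the Stieltjes measure of the function built from H. *)
theory Submission
  imports Defs
begin

text \<open>Since \<open>\<sigma> ^^ q = id\<close>, the power of \<open>\<sigma>\<close> attached
  to a cell depends only on the last digit of the cell number. One digit of memory closes the
  dynamics, which is why a state is a pair. The obstacle is that the derivative of a coefficient
  involves lower coefficients, and its error involves the error itself, at another state. Pointwise
  differentiability would not survive the induction on the degree, so it is proved uniformly in the
  state. Taylor coefficients replace derivatives because the product rule then carries no binomial
  factors: differentiating the coefficient of u with respect to r_l gives u_l + 1 times the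
  coefficient of u + e_l. The link with the Takagi functions is that \<open>Psi\<close> is the
  logarithmic derivative of the weight: multiplied by the mass of a cell, it replaces one factor of
  the product along the orbit by its derivative.\<close>

subsection \<open>Contractions along an orbit\<close>

text \<open>Taking suprema in the second assumption gives s <= epsilon + rho * s. Boundedness is
  only needed to make s finite, so that it can be absorbed; the size of \<open>C\<close> does not
  enter the bound.\<close>

lemma contraction_bound:
  fixes g :: "'a \<Rightarrow> real"
  assumes bounded: "\<And>z. \<bar>g z\<bar> \<le> C"
    and contr: "\<And>z. \<bar>g z\<bar> \<le> \<epsilon> + \<rho> * \<bar>g (T z)\<bar>"
    and \<rho>: "0 \<le> \<rho>" "\<rho> < 1"
  shows "\<bar>g z\<bar> \<le> \<epsilon> / (1 - \<rho>)"
proof -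
  define s where "s = (SUP z. \<bar>g z\<bar>)"
  have bdd: "bdd_above (range (\<lambda>z. \<bar>g z\<bar>))" using bounded by (intro bdd_aboveI) auto
  have le: "\<bar>g z\<bar> \<le> s" for z unfolding s_def by (intro cSUP_upper bdd) auto
  have "s \<le> \<epsilon> + \<rho> * s" unfolding s_def
  proof (rule cSUP_least)
    fix z
    have "\<rho> * \<bar>g (T z)\<bar> \<le> \<rho> * s" using le \<rho> by (intro mult_left_mono) auto
    then show "\<bar>g z\<bar> \<le> \<epsilon> + \<rho> * (SUP z. \<bar>g z\<bar>)" using contr[of z] unfolding s_def by linarith
  qed simp
  then have "s \<le> \<epsilon> / (1 - \<rho>)" using \<rho> by (simp add: field_simps)
  then show ?thesis using le[of z] by linarith
qed

text \<open>The negative part of \<open>g\<close> satisfies a contraction inequality without source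
  term, so it vanishes by \<open>contraction_bound\<close>.\<close>

lemma contraction_nonneg:
  fixes g :: "'a \<Rightarrow> real"
  assumes bounded: "\<And>z. - C \<le> g z"
    and step: "\<And>z. w z * g (T z) \<le> g z"
    and w: "\<And>z. 0 \<le> w z" "\<And>z. w z \<le> \<rho>" "\<rho> < 1"
  shows "0 \<le> g z"
proof -
  define h where "h z = max 0 (- g z)" for z
  have \<rho>: "0 \<le> \<rho>" using w(1,2) order_trans by blast
  have "\<bar>h z\<bar> \<le> 0 / (1 - \<rho>)"
  proof (rule contraction_bound[where T = T and C = "\<bar>C\<bar>"])
    show "\<bar>h z\<bar> \<le> \<bar>C\<bar>" for z using bounded[of z] by (auto simp: h_def)
    show "\<bar>h z\<bar> \<le> 0 + \<rho> * \<bar>h (T z)\<bar>" for z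
    proof -
      have "- g z \<le> w z * h (T z)"
        using step[of z] mult_left_mono[of "- g (T z)" "h (T z)" "w z"] w(1)[of z] by (auto simp: h_def)
      also have "\<dots> \<le> \<rho> * h (T z)" using w(2)[of z] by (intro mult_right_mono) (auto simp: h_def)
      finally have "- g z \<le> \<rho> * h (T z)" .
      moreover have "0 \<le> \<rho> * h (T z)" using \<rho> by (simp add: h_def)
      ultimately show ?thesis by (simp add: h_def)
    qed
  qed (use \<rho> w in auto)
  then show ?thesis by (simp add: h_def)
qed

section \<open>Series solution of an affine transfer equation\<close>

definition weighted_series :: "('a \<Rightarrow> real) \<Rightarrow> ('a \<Rightarrow> 'a) \<Rightarrow> ('a \<Rightarrow> real) \<Rightarrow> 'a \<Rightarrow> real" where
  "weighted_series w T S z = (\<Sum>k. (\<Prod>i<k. w ((T ^^ i) z)) * S ((T ^^ k) z))"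

context
  fixes w :: "'a \<Rightarrow> real" and T :: "'a \<Rightarrow> 'a" and S :: "'a \<Rightarrow> real" and \<rho> K :: real
  assumes w: "\<And>z. 0 \<le> w z" "\<And>z. w z \<le> \<rho>" "\<rho> < 1"
    and S: "\<And>z. \<bar>S z\<bar> \<le> K"
begin

lemma weighted_series_term_bound:
  "\<bar>(\<Prod>i<k. w ((T ^^ i) z)) * S ((T ^^ k) z)\<bar> \<le> K * \<rho> ^ k"
proof -
  have "(\<Prod>i<k. w ((T ^^ i) z)) \<le> (\<Prod>i<k. \<rho>)" by (intro prod_mono) (use w in auto)
  moreover have "0 \<le> (\<Prod>i<k. w ((T ^^ i) z))" by (intro prod_nonneg) (use w in auto)
  ultimately have "(\<Prod>i<k. w ((T ^^ i) z)) * \<bar>S ((T ^^ k) z)\<bar> \<le> \<rho> ^ k * K"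
    by (intro mult_mono) (use S in auto)
  then show ?thesis using \<open>0 \<le> (\<Prod>i<k. w ((T ^^ i) z))\<close> by (simp add: abs_mult mult.commute)
qed

lemma summable_weighted_series:
  "summable (\<lambda>k. (\<Prod>i<k. w ((T ^^ i) z)) * S ((T ^^ k) z))"
proof (rule summable_comparison_test')
  have "0 \<le> \<rho>" using w(1,2) order_trans by blast
  then show "summable (\<lambda>k. K * \<rho> ^ k)" using w(3) by (intro summable_mult summable_geometric) auto
qed (use weighted_series_term_bound in auto)

lemma weighted_series_bound: "\<bar>weighted_series w T S z\<bar> \<le> K / (1 - \<rho>)"
proof -
  have \<rho>: "0 \<le> \<rho>" using w(1,2) order_trans by blast
  have s: "summable (\<lambda>k. K * \<rho> ^ k)" using w(3) \<rho> by (intro summable_mult summable_geometric) auto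
  have "\<bar>weighted_series w T S z\<bar> \<le> (\<Sum>k. K * \<rho> ^ k)" unfolding weighted_series_def
    using norm_suminf_le[OF _ s, of "\<lambda>k. (\<Prod>i<k. w ((T ^^ i) z)) * S ((T ^^ k) z)"]
      weighted_series_term_bound by simp
  also have "\<dots> = K / (1 - \<rho>)"
    using \<rho> w(3) suminf_mult[OF summable_geometric, of \<rho> K] suminf_geometric[of \<rho>] by simp
  finally show ?thesis .
qed

lemma weighted_series_eq: "weighted_series w T S z = S z + w z * weighted_series w T S (T z)"
proof -
  have e: "(\<Prod>i<Suc k. w ((T ^^ i) z)) * S ((T ^^ Suc k) z) =
      w z * ((\<Prod>i<k. w ((T ^^ i) (T z))) * S ((T ^^ k) (T z)))" for k
    by (subst prod.lessThan_Suc_shift) (simp add: funpow_swap1)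
  have "weighted_series w T S z = S z + (\<Sum>k. (\<Prod>i<Suc k. w ((T ^^ i) z)) * S ((T ^^ Suc k) z))"
    unfolding weighted_series_def using suminf_split_head[OF summable_weighted_series[of z]]
    by simp
  then show ?thesis unfolding e weighted_series_def
    using suminf_mult[OF summable_weighted_series[of "T z"], of "w z"] by simp
qed

end

text \<open>In effect differentiability at t = 0 for the supremum norm over z. Pointwise
  differentiability would be too weak, because the transfer equation compares the error at z with
  the error at \<open>T z\<close>.\<close>

definition uniform_deriv :: "(real \<Rightarrow> 'a \<Rightarrow> real) \<Rightarrow> ('a \<Rightarrow> real) \<Rightarrow> bool" where
  "uniform_deriv f f' \<longleftrightarrow>
     (\<forall>\<epsilon>>0. \<exists>\<delta>>0. \<forall>t z. \<bar>t\<bar> < \<delta> \<longrightarrow> \<bar>f t z - f 0 z - t * f' z\<bar> \<le> \<epsilon> * \<bar>t\<bar>)"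

lemma uniform_deriv_affine: "(\<And>t z. f t z = f 0 z + t * f' z) \<Longrightarrow> uniform_deriv f f'"
  unfolding uniform_deriv_def
proof (intro allI impI)
  fix \<epsilon> :: real assume e: "\<And>t z. f t z = f 0 z + t * f' z" and "0 < \<epsilon>"
  have "f t z - f 0 z - t * f' z = 0" for t z using e[of t z] by linarith
  then have "\<bar>f t z - f 0 z - t * f' z\<bar> \<le> \<epsilon> * \<bar>t\<bar>" for t z using \<open>0 < \<epsilon>\<close> by simp
  then show "\<exists>\<delta>>0. \<forall>t z. \<bar>t\<bar> < \<delta> \<longrightarrow> \<bar>f t z - f 0 z - t * f' z\<bar> \<le> \<epsilon> * \<bar>t\<bar>"
    using zero_less_one by blast
qed

lemma uniform_deriv_add:
  assumes "uniform_deriv f f'" "uniform_deriv g g'"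
  shows "uniform_deriv (\<lambda>t z. f t z + g t z) (\<lambda>z. f' z + g' z)"
  unfolding uniform_deriv_def
proof (intro allI impI)
  fix \<epsilon> :: real assume \<epsilon>: "0 < \<epsilon>"
  then have "0 < \<epsilon> / 2" by simp
  then obtain a where a: "a > 0" "\<And>t z. \<bar>t\<bar> < a \<Longrightarrow> \<bar>f t z - f 0 z - t * f' z\<bar> \<le> \<epsilon> / 2 * \<bar>t\<bar>"
    using assms(1) unfolding uniform_deriv_def by meson
  obtain b where b: "b > 0" "\<And>t z. \<bar>t\<bar> < b \<Longrightarrow> \<bar>g t z - g 0 z - t * g' z\<bar> \<le> \<epsilon> / 2 * \<bar>t\<bar>"
    using assms(2) \<open>0 < \<epsilon> / 2\<close> unfolding uniform_deriv_def by meson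
  have "\<bar>(f t z + g t z) - (f 0 z + g 0 z) - t * (f' z + g' z)\<bar> \<le> \<epsilon> * \<bar>t\<bar>"
    if "\<bar>t\<bar> < min a b" for t z
  proof -
    have "(f t z + g t z) - (f 0 z + g 0 z) - t * (f' z + g' z) =
      (f t z - f 0 z - t * f' z) + (g t z - g 0 z - t * g' z)" by (simp add: algebra_simps)
    then show ?thesis using a(2)[of t z] b(2)[of t z] that by linarith
  qed
  then show "\<exists>\<delta>>0. \<forall>t z. \<bar>t\<bar> < \<delta> \<longrightarrow>
      \<bar>(f t z + g t z) - (f 0 z + g 0 z) - t * (f' z + g' z)\<bar> \<le> \<epsilon> * \<bar>t\<bar>"
    using a(1) b(1) by (intro exI[of _ "min a b"]) auto
qed

lemma uniform_deriv_sum: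
  assumes "finite A" "\<And>a. a \<in> A \<Longrightarrow> uniform_deriv (f a) (f' a)"
  shows "uniform_deriv (\<lambda>t z. \<Sum>a\<in>A. f a t z) (\<lambda>z. \<Sum>a\<in>A. f' a z)"
  using assms
proof (induction A rule: finite_induct)
  case empty
  then show ?case by (auto intro: uniform_deriv_affine)
next
  case (insert a A)
  then show ?case using uniform_deriv_add[of "f a" "f' a"] by simp
qed

text \<open>In the sources, \<open>c\<close> is \<open>dweight a\<close> and \<open>T\<close> is
  \<open>step\<close>. Composition with \<open>T\<close> costs nothing because the modulus does not
  depend on z.\<close>

lemma uniform_deriv_mult_compose:
  assumes "uniform_deriv f f'" "\<And>z. \<bar>c z\<bar> \<le> 1"
  shows "uniform_deriv (\<lambda>t z. c z * f t (T z)) (\<lambda>z. c z * f' (T z))"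
  unfolding uniform_deriv_def
proof (intro allI impI)
  fix \<epsilon> :: real assume "0 < \<epsilon>"
  then obtain a where a: "a > 0" "\<And>t z. \<bar>t\<bar> < a \<Longrightarrow> \<bar>f t z - f 0 z - t * f' z\<bar> \<le> \<epsilon> * \<bar>t\<bar>"
    using assms(1) unfolding uniform_deriv_def by meson
  have "\<bar>c z * f t (T z) - c z * f 0 (T z) - t * (c z * f' (T z))\<bar> \<le> \<epsilon> * \<bar>t\<bar>" if "\<bar>t\<bar> < a" for t z
  proof -
    have "c z * f t (T z) - c z * f 0 (T z) - t * (c z * f' (T z)) =
      c z * (f t (T z) - f 0 (T z) - t * f' (T z))" by (simp add: algebra_simps)
    also have "\<bar>\<dots>\<bar> \<le> 1 * (\<epsilon> * \<bar>t\<bar>)"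
      unfolding abs_mult using a(2)[OF that] assms(2) by (intro mult_mono) auto
    finally show ?thesis by simp
  qed
  then show "\<exists>\<delta>>0. \<forall>t z. \<bar>t\<bar> < \<delta> \<longrightarrow>
      \<bar>c z * f t (T z) - c z * f 0 (T z) - t * (c z * f' (T z))\<bar> \<le> \<epsilon> * \<bar>t\<bar>"
    using a(1) by blast
qed

text \<open>The error of the linear approximation obeys a transfer equation with the perturbed
  weight \<open>w z + t * w' z\<close>; its source is the error of \<open>S\<close> plus the
  quadratic term \<open>t * w' z * (t * f' (T z))\<close>. The bound on \<open>f t\<close> may
  depend on t, since only its finiteness matters.\<close>

lemma uniform_deriv_fixed_point:
  fixes f :: "real \<Rightarrow> 'a \<Rightarrow> real" and w w' :: "'a \<Rightarrow> real" and T :: "'a \<Rightarrow> 'a"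
  assumes \<delta>\<^sub>0: "0 < \<delta>\<^sub>0"
    and f: "\<And>t z. \<bar>t\<bar> < \<delta>\<^sub>0 \<Longrightarrow> f t z = S t z + (w z + t * w' z) * f t (T z)"
    and f_bounded: "\<And>t. \<bar>t\<bar> < \<delta>\<^sub>0 \<Longrightarrow> \<exists>C. \<forall>z. \<bar>f t z\<bar> \<le> C"
    and f': "\<And>z. f' z = S' z + w' z * f 0 (T z) + w z * f' (T z)"
    and f'_bounded: "\<And>z. \<bar>f' z\<bar> \<le> C"
    and w: "\<And>z. \<bar>w z\<bar> \<le> \<rho>" "\<rho> < 1"
    and w': "\<And>z. \<bar>w' z\<bar> \<le> 1"
    and S: "uniform_deriv S S'"
  shows "uniform_deriv f f'"
  unfolding uniform_deriv_def
proof (intro allI impI)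
  fix \<epsilon> :: real assume \<epsilon>: "0 < \<epsilon>"
  have \<rho>: "0 \<le> \<rho>" using w(1) abs_ge_zero order_trans by blast
  have C: "0 \<le> C" using f'_bounded abs_ge_zero order_trans by blast
  \<comment> \<open>Two source terms of size \<open>\<epsilon>' * \<bar>t\<bar>\<close> get divided
    by the contraction gap (1 - rho) / 2; the factor 4 makes the result exactly
    \<open>\<epsilon> * \<bar>t\<bar>\<close>.\<close>
  define \<epsilon>' where "\<epsilon>' = \<epsilon> * (1 - \<rho>) / 4"
  have "0 < \<epsilon>'" using \<epsilon> w(2) by (simp add: \<epsilon>'_def)
  then obtain a where a: "a > 0" "\<And>t z. \<bar>t\<bar> < a \<Longrightarrow> \<bar>S t z - S 0 z - t * S' z\<bar> \<le> \<epsilon>' * \<bar>t\<bar>"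
    using S unfolding uniform_deriv_def by meson
  \<comment> \<open>The four bounds provide, in order, the transfer equation at t, the estimate for
    \<open>S\<close>, a perturbed contraction factor of at most (1 + rho) / 2, and |t| * C <=
    epsilon'. The summand 1 keeps the denominator positive.\<close>
  define \<delta> where "\<delta> = Min {\<delta>\<^sub>0, a, (1 - \<rho>) / 2, \<epsilon>' / (C + 1)}"
  have \<delta>: "0 < \<delta>" using \<delta>\<^sub>0 a(1) w(2) \<open>0 < \<epsilon>'\<close> C by (simp add: \<delta>_def)
  have "\<bar>f t z - f 0 z - t * f' z\<bar> \<le> \<epsilon> * \<bar>t\<bar>" if t: "\<bar>t\<bar> < \<delta>" for t z
  proof -
    have td: "\<bar>t\<bar> < \<delta>\<^sub>0" "\<bar>t\<bar> < a" "\<bar>t\<bar> < (1 - \<rho>) / 2" "\<bar>t\<bar> < \<epsilon>' / (C + 1)"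
      using t by (auto simp: \<delta>_def)
    have tC: "\<bar>t\<bar> * C \<le> \<epsilon>'"
    proof -
      have "\<bar>t\<bar> * (C + 1) \<le> \<epsilon>'" using td(4) C by (simp add: field_simps)
      then show ?thesis using abs_ge_zero[of t] by (simp add: algebra_simps)
    qed
    define e where "e z = f t z - f 0 z - t * f' z" for z
    obtain A B where AB: "\<And>z. \<bar>f t z\<bar> \<le> A" "\<And>z. \<bar>f 0 z\<bar> \<le> B"
      using f_bounded[of t] f_bounded[of 0] td \<delta>\<^sub>0 by auto
    have "\<bar>e z\<bar> \<le> (2 * \<epsilon>' * \<bar>t\<bar>) / (1 - (1 + \<rho>) / 2)"
    proof (rule contraction_bound[where T = T and C = "A + B + \<bar>t\<bar> * C"])
      show "\<bar>e z\<bar> \<le> A + B + \<bar>t\<bar> * C" for z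
      proof -
        have "\<bar>t * f' z\<bar> \<le> \<bar>t\<bar> * C" unfolding abs_mult using f'_bounded by (intro mult_left_mono) auto
        then show ?thesis using AB(1)[of z] AB(2)[of z] unfolding e_def by linarith
      qed
      show "\<bar>e z\<bar> \<le> 2 * \<epsilon>' * \<bar>t\<bar> + (1 + \<rho>) / 2 * \<bar>e (T z)\<bar>" for z
      proof -
        have "f t z = S t z + (w z + t * w' z) * f t (T z)" "f 0 z = S 0 z + w z * f 0 (T z)"
          using f[of t z] f[of 0 z] td \<delta>\<^sub>0 by auto
        then have "e z = (S t z - S 0 z - t * S' z) + t * w' z * (t * f' (T z))
            + (w z + t * w' z) * e (T z)"
          unfolding e_def f'[of z] by (simp add: algebra_simps)
        moreover have "\<bar>S t z - S 0 z - t * S' z\<bar> \<le> \<epsilon>' * \<bar>t\<bar>" using a td by blast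
        moreover have "\<bar>t * w' z * (t * f' (T z))\<bar> \<le> \<epsilon>' * \<bar>t\<bar>"
        proof -
          have "\<bar>t * w' z * (t * f' (T z))\<bar> = \<bar>t\<bar> * \<bar>w' z\<bar> * (\<bar>t\<bar> * \<bar>f' (T z)\<bar>)" by (simp add: abs_mult)
          also have "\<dots> \<le> \<bar>t\<bar> * 1 * (\<bar>t\<bar> * C)"
            using w' f'_bounded C by (intro mult_mono) auto
          also have "\<dots> \<le> \<bar>t\<bar> * 1 * \<epsilon>'" using tC by (intro mult_left_mono) auto
          finally show ?thesis by (simp add: mult.commute)
        qed
        moreover have "\<bar>(w z + t * w' z) * e (T z)\<bar> \<le> (1 + \<rho>) / 2 * \<bar>e (T z)\<bar>"
        proof -
          have "\<bar>t * w' z\<bar> \<le> \<bar>t\<bar> * 1" unfolding abs_mult using w' by (intro mult_left_mono) auto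
          then have "\<bar>w z + t * w' z\<bar> \<le> (1 + \<rho>) / 2"
            using w(1)[of z] td(3) abs_triangle_ineq[of "w z" "t * w' z"] by argo
          then show ?thesis unfolding abs_mult by (intro mult_right_mono) auto
        qed
        ultimately show ?thesis by linarith
      qed
    qed (use \<rho> w in auto)
    also have "\<dots> = \<epsilon> * \<bar>t\<bar>" using w(2) by (simp add: \<epsilon>'_def field_simps)
    finally show ?thesis by (simp add: e_def)
  qed
  then show "\<exists>\<delta>>0. \<forall>t z. \<bar>t\<bar> < \<delta> \<longrightarrow> \<bar>f t z - f 0 z - t * f' z\<bar> \<le> \<epsilon> * \<bar>t\<bar>"
    using \<delta> by blast
qed


subsection \<open>Digits\<close>

locale digit_system =
  fixes q :: nat and \<sigma> :: "nat \<Rightarrow> nat"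
  assumes q_ge_2: "2 \<le> q"
    and \<sigma>_permutes: "\<sigma> permutes {..<q}"
    and \<sigma>_power_q: "\<sigma> ^^ q = id"
begin

lemma q_pos [simp]: "0 < q" and q_nonzero [simp]: "q \<noteq> 0"
  using q_ge_2 by auto

lemma \<sigma>_power_permutes: "(\<sigma> ^^ n) permutes {..<q}"
proof (induction n)
  case (Suc n)
  then show ?case using permutes_compose[OF Suc \<sigma>_permutes] by (simp only: funpow.simps)
qed (simp only: funpow.simps permutes_id)

lemma \<sigma>_power_less [simp]: "(\<sigma> ^^ n) l < q \<longleftrightarrow> l < q"
  using permutes_in_image[OF \<sigma>_power_permutes, of n l] by simp

lemma \<sigma>_power_mod: "\<sigma> ^^ (n mod q) = \<sigma> ^^ n"
proof -
  have "\<sigma> ^^ (q * k) = id" for k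
    by (induction k) (simp_all add: funpow_add \<sigma>_power_q)
  then have "\<sigma> ^^ (q * (n div q) + n mod q) = \<sigma> ^^ (n mod q)"
    unfolding funpow_add by simp
  then show ?thesis by simp
qed

lemma \<sigma>_power_inverse: "(\<sigma> ^^ j) ((inv \<sigma> ^^ j) l) = l" "(inv \<sigma> ^^ j) ((\<sigma> ^^ j) l) = l"
proof -
  have b: "bij \<sigma>" using \<sigma>_permutes by (rule permutes_bij)
  have e: "inv \<sigma> ^^ j = inv (\<sigma> ^^ j)" using b by (simp add: inv_fn)
  show "(\<sigma> ^^ j) ((inv \<sigma> ^^ j) l) = l" "(inv \<sigma> ^^ j) ((\<sigma> ^^ j) l) = l"
    unfolding e using permutes_inverses[OF \<sigma>_power_permutes] by auto
qed

text \<open>The minimum puts the right endpoint 1 into the last cell, in agreement with the closed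
  last interval of \<open>I\<close>.\<close>

definition cell :: "nat \<Rightarrow> real \<Rightarrow> nat" where
  "cell k x = min (q ^ k - 1) (nat \<lfloor>real q ^ k * x\<rfloor>)"

definition digit :: "real \<Rightarrow> nat" where
  "digit x = cell 1 x"

lemma cell_less [simp]: "cell k x < q ^ k"
proof -
  have "0 < q ^ k" by simp
  then show ?thesis unfolding cell_def by linarith
qed

lemma cell_0 [simp]: "cell 0 x = 0"
  using cell_less[of 0 x] by simp

lemma digit_less [simp]: "digit x < q"
  using cell_less[of 1 x] by (simp add: digit_def)

lemma cell_eq_nat_floor:
  assumes "0 \<le> x" "x < 1"
  shows "cell k x = nat \<lfloor>real q ^ k * x\<rfloor>"
proof -
  have "real q ^ k * x < real q ^ k" using assms by simp
  then have "\<lfloor>real q ^ k * x\<rfloor> < int (q ^ k)" by (simp add: floor_less_iff)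
  then show ?thesis unfolding cell_def by linarith
qed

lemma real_pow_pred: "real (q ^ k - Suc 0) = real q ^ k - 1"
  by (simp add: of_nat_diff Suc_leI)

lemma cell_1_right: "cell k 1 = q ^ k - 1"
proof -
  have "nat \<lfloor>real q ^ k\<rfloor> = q ^ k" by (metis floor_of_nat nat_int of_nat_power)
  then show ?thesis by (simp add: cell_def)
qed

lemma cell_le: "0 \<le> x \<Longrightarrow> x \<le> 1 \<Longrightarrow> real (cell k x) \<le> real q ^ k * x"
proof -
  assume "0 \<le> x" "x \<le> 1"
  then have "real (nat \<lfloor>real q ^ k * x\<rfloor>) \<le> real q ^ k * x" by simp
  moreover have "cell k x \<le> nat \<lfloor>real q ^ k * x\<rfloor>" by (simp add: cell_def)
  ultimately show ?thesis by linarith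
qed

lemma less_cell:
  assumes "0 \<le> x" "x < 1"
  shows "real q ^ k * x < real (cell k x) + 1"
  using assms by (simp add: cell_eq_nat_floor)

lemma le_cell:
  assumes "0 \<le> x" "x \<le> 1"
  shows "real q ^ k * x \<le> real (cell k x) + 1"
proof (cases "x = 1")
  case True
  then show ?thesis by (simp add: cell_1_right real_pow_pred)
next
  case False
  then show ?thesis using less_cell[of x k] assms by auto
qed

lemma cell_unique:
  assumes "0 \<le> x" "x < 1" "real n \<le> real q ^ k * x" "real q ^ k * x < real n + 1"
  shows "cell k x = n"
proof -
  have "\<lfloor>real q ^ k * x\<rfloor> = int n" using assms by (intro floor_unique) auto
  then show ?thesis using assms by (simp add: cell_eq_nat_floor)
qed

lemma mem_I_iff_cell:
  assumes "0 \<le> x" "x \<le> 1" "n < q ^ k"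
  shows "x \<in> I q k n \<longleftrightarrow> cell k x = n"
proof (cases "x = 1")
  case True
  have "real (n + 1) / real q ^ k \<le> 1"
  proof -
    have "real (n + 1) \<le> real (q ^ k)" using assms(3) by (intro of_nat_mono) simp
    then show ?thesis by (simp add: divide_simps)
  qed
  then show ?thesis using True assms(3) by (auto simp: I_def cell_1_right divide_simps)
next
  case False
  then have x: "x < 1" using assms by simp
  have p: "0 < real q ^ k" by simp
  show ?thesis
  proof
    assume "x \<in> I q k n"
    then have "real n \<le> real q ^ k * x" "real q ^ k * x < real n + 1"
      using x p by (auto simp: I_def field_simps real_pow_pred split: if_splits)
    then show "cell k x = n" using cell_unique assms x by blast
  next
    assume "cell k x = n"
    then show "x \<in> I q k n" using cell_le[of x k] less_cell[of x k] assms x p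
      by (auto simp: I_def field_simps)
  qed
qed

lemma I_subset: "n < q ^ k \<Longrightarrow> I q k n \<subseteq> {0..1}"
proof
  fix x assume n: "n < q ^ k" and x: "x \<in> I q k n"
  have "real (n + 1) \<le> real (q ^ k)" using n by (intro of_nat_mono) simp
  then have "real (n + 1) / real q ^ k \<le> 1" by (simp add: divide_simps)
  moreover have "0 \<le> real n / real q ^ k" by simp
  moreover have "real n / real q ^ k \<le> x" "x \<le> 1 \<or> x \<le> real (n + 1) / real q ^ k"
    using x by (auto simp: I_def split: if_splits)
  ultimately show "x \<in> {0..1}" by (metis atLeastAtMost_iff order_trans)
qed

lemma mem_I_cell: "0 \<le> x \<Longrightarrow> x \<le> 1 \<Longrightarrow> x \<in> I q k (cell k x)"
  by (simp add: mem_I_iff_cell)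

lemma indicator_I:
  "0 \<le> x \<Longrightarrow> x \<le> 1 \<Longrightarrow> n < q ^ k \<Longrightarrow> indicat_real (I q k n) x = (if n = cell k x then 1 else 0)"
  by (auto simp: mem_I_iff_cell)

lemma indicator_I1:
  "0 \<le> x \<Longrightarrow> x \<le> 1 \<Longrightarrow> n < q \<Longrightarrow> indicat_real (I q 1 n) x = (if n = digit x then 1 else 0)"
  using indicator_I[of x n 1] by (simp add: digit_def)

lemma shift_1 [simp]: "shift q 1 = 1" and shift_0 [simp]: "shift q 0 = 0"
  by (auto simp: shift_def)

lemma shift_bounds: "0 \<le> x \<Longrightarrow> x \<le> 1 \<Longrightarrow> 0 \<le> shift q x \<and> shift q x \<le> 1"
  by (auto simp: shift_def frac_lt_1 less_imp_le)

lemma shift_less_1: "x \<noteq> 1 \<Longrightarrow> shift q x < 1"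
  by (auto simp: shift_def frac_lt_1)

lemma shift_eq: "0 \<le> x \<Longrightarrow> x < 1 \<Longrightarrow> shift q x = real q * x - real (digit x)"
  by (auto simp: shift_def frac_def digit_def cell_eq_nat_floor)

lemma shift_pow_bounds: "0 \<le> x \<Longrightarrow> x \<le> 1 \<Longrightarrow> 0 \<le> (shift q ^^ k) x \<and> (shift q ^^ k) x \<le> 1"
  by (induction k) (auto simp: shift_bounds)

lemma shift_pow_1 [simp]: "(shift q ^^ k) 1 = 1"
  by (induction k) auto

text \<open>Both parts go through one induction: the next digit is read off the rescaled position,
  and subtracting it gives the next rescaled position.\<close>

lemma cell_Suc_shift_pow:
  assumes "0 \<le> x" "x < 1"
  shows "cell (Suc k) x = q * cell k x + digit ((shift q ^^ k) x) \<and>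
    (shift q ^^ k) x = real q ^ k * x - real (cell k x)"
proof (induction k)
  case 0
  then show ?case using assms by (simp add: digit_def)
next
  case (Suc k)
  let ?y = "(shift q ^^ k) x"
  have y: "0 \<le> ?y" "?y < 1" using Suc cell_le[of x k] less_cell[of x k] assms by auto
  have s: "shift q ?y = real q ^ Suc k * x - real (cell (Suc k) x)"
  proof -
    have c: "cell (Suc k) x = q * cell k x + digit ?y" and e: "?y = real q ^ k * x - real (cell k x)"
      using Suc by auto
    have "shift q ?y = real q * ?y - real (digit ?y)" by (rule shift_eq[OF y])
    moreover have "real q * ?y = real q ^ Suc k * x - real q * real (cell k x)"
      by (subst e) (simp add: algebra_simps)
    ultimately show ?thesis unfolding c by simp
  qed
  have sb: "0 \<le> shift q ?y" "shift q ?y < 1" using y shift_bounds[of ?y] shift_less_1[of ?y] by auto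
  have "cell (Suc (Suc k)) x = q * cell (Suc k) x + digit (shift q ?y)"
  proof (rule cell_unique[OF assms])
    have d: "real (digit (shift q ?y)) \<le> real q * shift q ?y"
        "real q * shift q ?y < real (digit (shift q ?y)) + 1"
      using cell_le[of "shift q ?y" 1] less_cell[of "shift q ?y" 1] sb by (auto simp: digit_def)
    have e: "real q ^ Suc (Suc k) * x = real q * shift q ?y + real q * real (cell (Suc k) x)"
      unfolding s by (simp add: algebra_simps)
    show "real (q * cell (Suc k) x + digit (shift q ?y)) \<le> real q ^ Suc (Suc k) * x"
      "real q ^ Suc (Suc k) * x < real (q * cell (Suc k) x + digit (shift q ?y)) + 1"
      unfolding e using d by auto
  qed
  then show ?case using s by simp
qed

lemma cell_Suc:
  assumes "0 \<le> x" "x \<le> 1"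
  shows "cell (Suc k) x = q * cell k x + digit ((shift q ^^ k) x)"
proof (cases "x = 1")
  case True
  have "q * (q ^ k - 1) + (q - 1) = q * q ^ k - 1"
    using q_ge_2 by (simp add: algebra_simps)
  then show ?thesis using True by (simp add: cell_1_right digit_def)
next
  case False
  then show ?thesis using cell_Suc_shift_pow assms by auto
qed

lemma cell_Suc_div: "0 \<le> x \<Longrightarrow> x \<le> 1 \<Longrightarrow> cell (Suc k) x div q = cell k x"
  and cell_Suc_mod: "0 \<le> x \<Longrightarrow> x \<le> 1 \<Longrightarrow> cell (Suc k) x mod q = digit ((shift q ^^ k) x)"
  by (simp_all add: cell_Suc)

lemma cell_mono: "x \<le> y \<Longrightarrow> cell k x \<le> cell k y"
  unfolding cell_def by (intro min.mono nat_mono floor_mono mult_left_mono) auto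

lemma cell_grid:
  assumes "n < q ^ k"
  shows "cell k (real n / real q ^ k) = n" "(shift q ^^ k) (real n / real q ^ k) = 0"
proof -
  have p: "0 < real q ^ k" by simp
  have "real n < real (q ^ k)" using assms by (simp only: of_nat_less_iff)
  then have b: "0 \<le> real n / real q ^ k" "real n / real q ^ k < 1" by (auto simp: divide_simps)
  show c: "cell k (real n / real q ^ k) = n" using b by (intro cell_unique) auto
  show "(shift q ^^ k) (real n / real q ^ k) = 0" using cell_Suc_shift_pow[OF b] c by simp
qed

lemma digit_0 [simp]: "digit 0 = 0" and digit_1 [simp]: "digit 1 = q - 1"
  by (simp_all add: digit_def cell_1_right) (simp add: cell_def)

text \<open>More than two cell widths between x and y suffice, as \<open>le_cell\<close> at y loses
  at most one. The level is a successor because cell masses are prescribed from level one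
  on.\<close>

lemma cells_separate:
  assumes "0 \<le> x" "x < y" "y \<le> 1"
  shows "\<exists>k. cell (Suc k) x < cell (Suc k) y"
proof -
  obtain k where k: "2 / (y - x) < real q ^ k"
    using real_arch_pow[of "real q" "2 / (y - x)"] q_ge_2 by auto
  also have "\<dots> \<le> real q ^ Suc k" using q_ge_2 by (intro power_increasing) auto
  finally have "2 < real q ^ Suc k * (y - x)" using assms by (simp add: field_simps)
  moreover have "real q ^ Suc k * x \<ge> real (cell (Suc k) x)"
    using cell_le[of x "Suc k"] assms by linarith
  moreover have "real q ^ Suc k * y \<le> real (cell (Suc k) y) + 1"
    using le_cell[of y "Suc k"] assms by linarith
  ultimately have "real (cell (Suc k) x) < real (cell (Suc k) y)" by (simp add: algebra_simps)
  then show ?thesis by auto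
qed


subsection \<open>Probability vectors\<close>

lemma completed_pos: "admissible q d \<Longrightarrow> j < q \<Longrightarrow> 0 < completed q d j"
  by (auto simp: admissible_def completed_def)

lemma sum_completed: "(\<Sum>j<q. completed q d j) = 1"
proof -
  obtain p where p: "q = Suc p" using q_ge_2 by (cases q) auto
  show ?thesis unfolding p by (simp add: completed_def)
qed

lemma sum_completed_perm: "(\<Sum>j<q. completed q d ((\<sigma> ^^ n) j)) = 1"
  using sum.permute[OF \<sigma>_power_permutes, of "completed q d" n] sum_completed[of d] by (simp add: o_def)

lemma sum_pred: "(\<Sum>j<q. f j) = (\<Sum>j<q - 1. f j) + f (q - 1)" for f :: "nat \<Rightarrow> real"
  using sum.lessThan_Suc[of f "q - 1"] by simp

text \<open>As q is at least 2, there is another entry, and it is positive.\<close>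

lemma completed_less_1:
  assumes "admissible q d" "j < q"
  shows "completed q d j < 1"
proof -
  define i where "i = (if j = 0 then 1 else 0 :: nat)"
  have "i < q" "i \<noteq> j" using q_ge_2 by (auto simp: i_def)
  have "completed q d i + completed q d j = (\<Sum>a\<in>{i, j}. completed q d a)" using \<open>i \<noteq> j\<close> by simp
  also have "\<dots> \<le> (\<Sum>j<q. completed q d j)"
    using assms \<open>i < q\<close> by (intro sum_mono2) (auto simp: less_imp_le completed_pos)
  finally show ?thesis using sum_completed completed_pos[OF assms(1) \<open>i < q\<close>] by simp
qed

lemma completed_bound:
  assumes "admissible q d"
  obtains \<rho> where "0 < \<rho>" "\<rho> < 1" "\<And>j. j < q \<Longrightarrow> completed q d j \<le> \<rho>"
proof
  let ?\<rho> = "Max (completed q d ` {..<q})"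
  have ne: "completed q d ` {..<q} \<noteq> {}" using lessThan_empty_iff[of q] by simp
  show le: "completed q d j \<le> ?\<rho>" if "j < q" for j using that by (intro Max_ge) auto
  show "0 < ?\<rho>" using completed_pos[OF assms q_pos] le[OF q_pos] by linarith
  show "?\<rho> < 1" using ne completed_less_1[OF assms] by (subst Max_less_iff) auto
qed

text \<open>Only the last entry needs an argument: permuting all q entries preserves their sum, so
  the complement to 1 of the first q - 1 permuted entries is the last permuted entry.\<close>

lemma completed_perm_vec:
  assumes "j < q"
  shows "completed q (perm_vec q \<sigma> n d) j = completed q d ((\<sigma> ^^ n) j)"
proof (cases "j = q - 1")
  case True
  then show ?thesis using sum_completed_perm[of d n] sum_pred[of "\<lambda>j. completed q d ((\<sigma> ^^ n) j)"]
    by (simp add: completed_def[of q "perm_vec q \<sigma> n d"] perm_vec_def)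
qed (simp add: completed_def[of q "perm_vec q \<sigma> n d"] perm_vec_def)

text \<open>A form symmetric in all q entries, from which stability under permutation and under
  small changes of one parameter can be read off.\<close>

lemma admissible_iff: "admissible q d \<longleftrightarrow> (\<forall>j<q. 0 < completed q d j)"
proof
  assume "\<forall>j<q. 0 < completed q d j"
  then have pos: "0 < completed q d j" if "j < q" for j using that by blast
  have d: "completed q d j = d j" if "j < q - 1" for j using that by (simp add: completed_def)
  have d_pos: "0 < d j" if "j < q - 1" for j using pos[of j] d that by auto
  have lt: "(\<Sum>j<q - 1. d j) < 1" using pos[of "q - 1"] by (simp add: completed_def)
  have "0 < (\<Sum>j<q - 1. d j)" using d_pos q_ge_2 by (intro sum_pos) (auto simp: lessThan_empty_iff)
  moreover have "d j < 1" if "j < q - 1" for j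
    using member_le_sum[of j "{..<q - 1}" d] that d_pos lt by (auto simp: less_imp_le)
  ultimately show "admissible q d" using d_pos lt by (auto simp: admissible_def)
qed (use completed_pos in blast)

lemma admissible_perm_vec: "admissible q d \<Longrightarrow> admissible q (perm_vec q \<sigma> n d)"
  by (auto simp: admissible_iff completed_perm_vec)

lemma completed_uniform_vec: "j < q \<Longrightarrow> completed q (uniform_vec q) j = 1 / real q"
  by (auto simp: completed_def uniform_vec_def of_nat_diff field_simps)

lemma admissible_uniform_vec: "admissible q (uniform_vec q)"
  by (simp add: admissible_iff completed_uniform_vec)

text \<open>The partial derivative of \<open>completed q d j\<close> with respect to
  \<open>d l\<close>: raising \<open>d l\<close> lowers the last entry by the same amount.\<close>

definition dcompleted :: "nat \<Rightarrow> nat \<Rightarrow> real" where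
  "dcompleted l j = (if j = q - 1 then -1 else if j = l then 1 else 0)"

lemma completed_upd:
  assumes "l < q - 1"
  shows "completed q (d(l := t)) j = completed q d j + (t - d l) * dcompleted l j"
proof (cases "j = q - 1")
  case True
  have "(\<Sum>i<q - 1. (d(l := t)) i) = t + (\<Sum>i\<in>{..<q - 1} - {l}. d i)"
    using assms by (subst sum.remove[of _ l]) auto
  moreover have "(\<Sum>i<q - 1. d i) = d l + (\<Sum>i\<in>{..<q - 1} - {l}. d i)"
    using assms by (subst sum.remove[of _ l]) auto
  ultimately show ?thesis using True by (simp add: completed_def dcompleted_def)
qed (auto simp: completed_def dcompleted_def)

text \<open>This is the derivative of the constant sum in \<open>sum_completed_perm\<close>.\<close>

lemma sum_dcompleted_perm:
  assumes "l < q - 1"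
  shows "(\<Sum>j<q. dcompleted l ((\<sigma> ^^ n) j)) = 0"
proof -
  have "(\<Sum>j<q. dcompleted l ((\<sigma> ^^ n) j)) = (\<Sum>j<q. dcompleted l j)"
    using sum.permute[OF \<sigma>_power_permutes, of "dcompleted l" n] by (simp add: o_def)
  also have "\<dots> = (\<Sum>j<q - 1. if j = l then 1 else 0) - 1"
    unfolding sum_pred by (simp add: dcompleted_def)
  finally show ?thesis using assms by simp
qed

lemma admissible_upd:
  assumes "admissible q d" "l < q - 1"
  obtains \<delta> where "0 < \<delta>" "\<And>t. \<bar>t - d l\<bar> < \<delta> \<Longrightarrow> admissible q (d(l := t))"
proof
  \<comment> \<open>No entry moves by more than |t - d l|, since \<open>dcompleted\<close> has
    absolute value at most 1; the smallest entry is therefore a safe radius.\<close>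
  let ?\<delta> = "Min (completed q d ` {..<q})"
  have ne: "completed q d ` {..<q} \<noteq> {}" using lessThan_empty_iff[of q] by simp
  show "0 < ?\<delta>" using ne completed_pos[OF assms(1)] by (subst Min_gr_iff) auto
  show "admissible q (d(l := t))" if t: "\<bar>t - d l\<bar> < ?\<delta>" for t
    unfolding admissible_iff
  proof (intro allI impI)
    fix j assume "j < q"
    then have "?\<delta> \<le> completed q d j" by (intro Min_le) auto
    then have lt: "\<bar>t - d l\<bar> < completed q d j" using t by linarith
    have "\<bar>(t - d l) * dcompleted l j\<bar> \<le> \<bar>t - d l\<bar>"
      unfolding dcompleted_def by auto
    then show "0 < completed q (d(l := t)) j"
      unfolding completed_upd[OF assms(2)] using lt by linarith
  qed
qed


subsection \<open>The skew product and its transfer equation\<close>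

text \<open>A state \<open>(n, y)\<close> stands for a point \<open>y\<close> of a cell whose number is \<open>n\<close> modulo \<open>q\<close>, rescaled to
  the unit interval.\<close>

definition step :: "nat \<times> real \<Rightarrow> nat \<times> real" where
  "step z = (digit (snd z), shift q (snd z))"

text \<open>The conditional mass of the child cell that contains y, inside a cell whose number is
  congruent to the first component.\<close>

definition weight :: "(nat \<Rightarrow> real) \<Rightarrow> nat \<times> real \<Rightarrow> real" where
  "weight r z = completed q r ((\<sigma> ^^ fst z) (digit (snd z)))"

text \<open>The derivative of \<open>weight\<close> with respect to \<open>r l\<close>. It does not
  involve r because \<open>weight\<close> is affine in r.\<close>

definition dweight :: "nat \<Rightarrow> nat \<times> real \<Rightarrow> real" where
  "dweight l z = dcompleted l ((\<sigma> ^^ fst z) (digit (snd z)))"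

text \<open>The conditional mass of the children to the left of the one that contains y.\<close>

definition base :: "(nat \<Rightarrow> real) \<Rightarrow> nat \<times> real \<Rightarrow> real" where
  "base r z = (\<Sum>m<digit (snd z). completed q r ((\<sigma> ^^ fst z) m))"

definition dbase :: "nat \<Rightarrow> nat \<times> real \<Rightarrow> real" where
  "dbase l z = (\<Sum>m<digit (snd z). dcompleted l ((\<sigma> ^^ fst z) m))"

lemma step_pow: "(step ^^ k) (digit x, shift q x) = (digit ((shift q ^^ k) x), (shift q ^^ Suc k) x)"
  by (induction k) (simp_all add: step_def)

lemma weight_upd: "l < q - 1 \<Longrightarrow> weight (r(l := t)) z = weight r z + (t - r l) * dweight l z"
  by (simp add: weight_def dweight_def completed_upd)

lemma base_upd: "l < q - 1 \<Longrightarrow> base (r(l := t)) z = base r z + (t - r l) * dbase l z"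
  by (simp add: base_def dbase_def completed_upd sum.distrib sum_distrib_left)

lemma abs_dweight_le: "\<bar>dweight l z\<bar> \<le> 1"
  by (simp add: dweight_def dcompleted_def)

lemma abs_dbase_le: "\<bar>dbase l z\<bar> \<le> real q"
proof -
  have "\<bar>dbase l z\<bar> \<le> (\<Sum>m<digit (snd z). 1)"
    unfolding dbase_def by (rule order_trans[OF sum_abs sum_mono]) (simp add: dcompleted_def)
  also have "\<dots> \<le> real q" using less_imp_le[OF digit_less, of "snd z"] by simp
  finally show ?thesis .
qed

lemma weight_pos: "admissible q r \<Longrightarrow> 0 < weight r z"
  by (simp add: weight_def completed_pos)

lemma base_nonneg: "admissible q r \<Longrightarrow> 0 \<le> base r z"
  unfolding base_def
  by (rule sum_nonneg) (meson \<sigma>_power_less completed_pos digit_less lessThan_iff less_imp_le less_trans)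

lemma base_add_weight_le:
  assumes "admissible q r"
  shows "base r z + weight r z \<le> 1"
proof -
  let ?c = "\<lambda>m. completed q r ((\<sigma> ^^ fst z) m)"
  have "base r z + weight r z = (\<Sum>m<Suc (digit (snd z)). ?c m)"
    by (simp add: base_def weight_def)
  also have "\<dots> \<le> (\<Sum>m<q. ?c m)"
    using Suc_leI[OF digit_less, of "snd z"] assms
    by (intro sum_mono2) (auto simp: less_imp_le completed_pos)
  finally show ?thesis by (simp add: sum_completed_perm)
qed

lemma abs_base_le: "admissible q r \<Longrightarrow> \<bar>base r z\<bar> \<le> 1"
  using base_nonneg[of r z] base_add_weight_le[of r z] weight_pos[of r z] by linarith

lemma weight_bound:
  assumes "admissible q r"
  obtains \<rho> where "0 < \<rho>" "\<rho> < 1" "\<And>z. 0 \<le> weight r z" "\<And>z. weight r z \<le> \<rho>"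
proof -
  obtain \<rho> where \<rho>: "0 < \<rho>" "\<rho> < 1" "\<And>j. j < q \<Longrightarrow> completed q r j \<le> \<rho>"
    using completed_bound[OF assms] by blast
  have w: "0 < weight r z" "weight r z \<le> \<rho>" for z
    using weight_pos[OF assms] \<rho>(3) by (auto simp: weight_def)
  show ?thesis using that[OF \<rho>(1,2)] w by (auto simp: less_imp_le)
qed

text \<open>\<open>taylor n r u\<close> is the Taylor coefficient at \<open>r\<close>, for the multi-index \<open>u\<close> of degree \<open>n\<close>, of the
  distribution function at \<open>y\<close> of the measure with both vectors variable and first-level vector
  permuted by the state.\<close>

primrec taylor :: "nat \<Rightarrow> (nat \<Rightarrow> real) \<Rightarrow> (nat \<Rightarrow> nat) \<Rightarrow> nat \<times> real \<Rightarrow> real" where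
  "taylor 0 = (\<lambda>r u. weighted_series (weight r) step (base r))"
| "taylor (Suc n) = (\<lambda>r u. weighted_series (weight r) step
     (\<lambda>z. (if n = 0 then \<Sum>a<q - 1. real (u a) * dbase a z else 0) +
       (\<Sum>a | a < q - 1 \<and> 0 < u a. dweight a z * taylor n r (mi_minus u (mi_unit a)) (step z))))"

text \<open>The product rule for the transfer equation, minus the term that keeps the full degree.
  Since \<open>weight\<close> is affine, at most one unit of the degree falls on it, as
  \<open>dweight a\<close>; since \<open>base\<close> is affine, its derivative appears only in
  degree one, where \<open>real (u a)\<close> selects the parameter.\<close>

definition source :: "nat \<Rightarrow> (nat \<Rightarrow> real) \<Rightarrow> (nat \<Rightarrow> nat) \<Rightarrow> nat \<times> real \<Rightarrow> real" where
  "source n r u z = (case n of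
     0 \<Rightarrow> base r z
   | Suc m \<Rightarrow> (if m = 0 then \<Sum>a<q - 1. real (u a) * dbase a z else 0) +
       (\<Sum>a | a < q - 1 \<and> 0 < u a. dweight a z * taylor m r (mi_minus u (mi_unit a)) (step z)))"

lemma taylor_eq_series: "taylor n r u = weighted_series (weight r) step (source n r u)"
  by (cases n) (auto simp: source_def[abs_def])

text \<open>Joint induction: the source in degree n + 1 is built from coefficients of degree n, and
  a bounded source gives a bounded coefficient by \<open>weighted_series_bound\<close>.\<close>

lemma taylor_source_bounded:
  assumes "admissible q r"
  shows "(\<exists>K. \<forall>z. \<bar>source n r u z\<bar> \<le> K) \<and> (\<exists>C. \<forall>z. \<bar>taylor n r u z\<bar> \<le> C)"
proof (induction n arbitrary: u)
  case 0
  obtain \<rho> where \<rho>: "0 < \<rho>" "\<rho> < 1" "\<And>z. 0 \<le> weight r z" "\<And>z. weight r z \<le> \<rho>"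
    by (rule weight_bound[OF assms]) blast
  have K: "\<bar>source 0 r u z\<bar> \<le> 1" for z by (simp add: source_def abs_base_le assms)
  have "\<bar>taylor 0 r u z\<bar> \<le> 1 / (1 - \<rho>)" for z
    unfolding taylor_eq_series by (rule weighted_series_bound[OF \<rho>(3,4,2) K])
  then show ?case using K by blast
next
  case (Suc n)
  obtain \<rho> where \<rho>: "0 < \<rho>" "\<rho> < 1" "\<And>z. 0 \<le> weight r z" "\<And>z. weight r z \<le> \<rho>"
    by (rule weight_bound[OF assms]) blast
  have "\<forall>v. \<exists>C. \<forall>z. \<bar>taylor n r (mi_minus u (mi_unit v)) z\<bar> \<le> C" using Suc by blast
  then obtain C where C: "\<And>v z. \<bar>taylor n r (mi_minus u (mi_unit v)) z\<bar> \<le> C v"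
    unfolding choice_iff by blast
  have K: "\<bar>source (Suc n) r u z\<bar> \<le>
      (\<Sum>a<q - 1. real (u a) * real q) + (\<Sum>a | a < q - 1 \<and> 0 < u a. C a)" (is "_ \<le> ?K") for z
  proof -
    have "\<bar>\<Sum>a<q - 1. real (u a) * dbase a z\<bar> \<le> (\<Sum>a<q - 1. real (u a) * real q)"
      by (rule order_trans[OF sum_abs sum_mono]) (auto simp: abs_mult intro!: mult_left_mono abs_dbase_le)
    moreover have "0 \<le> (\<Sum>a<q - 1. real (u a) * real q)" by (intro sum_nonneg) auto
    moreover have "\<bar>\<Sum>a | a < q - 1 \<and> 0 < u a. dweight a z * taylor n r (mi_minus u (mi_unit a)) (step z)\<bar>
        \<le> (\<Sum>a | a < q - 1 \<and> 0 < u a. C a)"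
    proof (rule order_trans[OF sum_abs sum_mono])
      fix a
      have "\<bar>dweight a z * taylor n r (mi_minus u (mi_unit a)) (step z)\<bar> \<le> 1 * C a"
        unfolding abs_mult by (intro mult_mono abs_dweight_le C) auto
      then show "\<bar>dweight a z * taylor n r (mi_minus u (mi_unit a)) (step z)\<bar> \<le> C a" by simp
    qed
    ultimately show ?thesis
      unfolding source_def nat.case by (cases "n = 0"; simp only: if_True if_False simp_thms; linarith)
  qed
  have "\<bar>taylor (Suc n) r u z\<bar> \<le> ?K / (1 - \<rho>)" for z
    unfolding taylor_eq_series by (rule weighted_series_bound[OF \<rho>(3,4,2) K])
  then show ?case using K by blast
qed

lemma taylor_bounded: "admissible q r \<Longrightarrow> \<exists>C. \<forall>z. \<bar>taylor n r u z\<bar> \<le> C"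
  using taylor_source_bounded by blast

lemma taylor_eq:
  assumes "admissible q r"
  shows "taylor n r u z = source n r u z + weight r z * taylor n r u (step z)"
proof -
  obtain \<rho> where \<rho>: "0 < \<rho>" "\<rho> < 1" "\<And>z. 0 \<le> weight r z" "\<And>z. weight r z \<le> \<rho>"
    by (rule weight_bound[OF assms]) blast
  obtain K where "\<And>z. \<bar>source n r u z\<bar> \<le> K" using taylor_source_bounded[OF assms] by blast
  then show ?thesis unfolding taylor_eq_series by (rule weighted_series_eq[OF \<rho>(3,4,2)])
qed

text \<open>Multi-indices are total functions of which only the entries below q - 1 count; this
  identifies those that agree there, such as \<open>u\<close> and the counts of
  \<open>mi_list q u\<close>.\<close>

lemma taylor_cong:
  assumes "\<And>a. a < q - 1 \<Longrightarrow> u a = v a"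
  shows "taylor n r u = taylor n r v"
  using assms
proof (induction n arbitrary: u v)
  case 0
  then show ?case by (simp add: source_def[abs_def])
next
  case (Suc n)
  have "taylor n r (mi_minus u (mi_unit a)) = taylor n r (mi_minus v (mi_unit a))" for a
    by (rule Suc.IH) (simp add: mi_minus_def Suc.prems)
  moreover have "{a. a < q - 1 \<and> 0 < u a} = {a. a < q - 1 \<and> 0 < v a}" using Suc.prems by auto
  ultimately have "source (Suc n) r u = source (Suc n) r v"
    using Suc.prems by (auto simp: source_def[abs_def] intro!: ext sum.cong)
  then show ?case unfolding taylor_eq_series by simp
qed

lemma taylor_0_nonneg:
  assumes "admissible q r"
  shows "0 \<le> taylor 0 r u z"
proof -
  obtain \<rho> where \<rho>: "0 < \<rho>" "\<rho> < 1" "\<And>z. 0 \<le> weight r z" "\<And>z. weight r z \<le> \<rho>"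
    by (rule weight_bound[OF assms]) blast
  obtain C where C: "\<And>z. \<bar>taylor 0 r u z\<bar> \<le> C" using taylor_bounded[OF assms] by blast
  show ?thesis
  proof (rule contraction_nonneg[where T = step and w = "weight r", OF _ _ \<rho>(3,4,2)])
    show "- C \<le> taylor 0 r u z" for z using C[of z] by linarith
    show "weight r z * taylor 0 r u (step z) \<le> taylor 0 r u z" for z
      using taylor_eq[OF assms, of 0 u z] base_nonneg[OF assms, of z] by (simp add: source_def)
  qed
qed

text \<open>The complement to 1 satisfies the hypothesis of \<open>contraction_nonneg\<close>
  because \<open>base\<close> and \<open>weight\<close> sum to at most 1.\<close>

lemma taylor_0_le_1:
  assumes "admissible q r"
  shows "taylor 0 r u z \<le> 1"
proof -
  obtain \<rho> where \<rho>: "0 < \<rho>" "\<rho> < 1" "\<And>z. 0 \<le> weight r z" "\<And>z. weight r z \<le> \<rho>"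
    by (rule weight_bound[OF assms]) blast
  obtain C where C: "\<And>z. \<bar>taylor 0 r u z\<bar> \<le> C" using taylor_bounded[OF assms] by blast
  have "0 \<le> 1 - taylor 0 r u z"
  proof (rule contraction_nonneg[where T = step and w = "weight r", OF _ _ \<rho>(3,4,2)])
    show "- C \<le> 1 - taylor 0 r u z" for z using C[of z] by linarith
    show "weight r z * (1 - taylor 0 r u (step z)) \<le> 1 - taylor 0 r u z" for z
      using taylor_eq[OF assms, of 0 u z] base_add_weight_le[OF assms, of z]
      by (simp add: source_def algebra_simps)
  qed
  then show ?thesis by simp
qed

text \<open>The state (0, 0) is fixed by \<open>step\<close>, so there the transfer equation reads h
  = w * h with w < 1. Every (n, 0) reaches it in one step.\<close>

lemma taylor_0_at_0:
  assumes "admissible q r"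
  shows "taylor 0 r u (n, 0) = 0"
proof -
  have e: "taylor 0 r u (m, 0) = weight r (m, 0) * taylor 0 r u (0, 0)" for m
    using taylor_eq[OF assms, of 0 u "(m, 0)"] by (simp add: source_def base_def step_def)
  have "weight r (0, 0) < 1" using completed_less_1[OF assms, of 0] by (simp add: weight_def)
  then have "taylor 0 r u (0, 0) = 0" using e[of 0] by auto
  then show ?thesis using e[of n] by simp
qed

text \<open>The same argument for the complement to 1 at the fixed state (q - 1, 1); at the last
  digit, \<open>base\<close> and \<open>weight\<close> sum to exactly 1.\<close>

lemma taylor_0_at_1:
  assumes "admissible q r"
  shows "taylor 0 r u (n, 1) = 1"
proof -
  have b: "base r (m, 1) = 1 - weight r (m, 1)" for m
    using sum_pred[of "\<lambda>j. completed q r ((\<sigma> ^^ m) j)"] sum_completed_perm[of r m]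
    by (simp add: base_def weight_def)
  have e: "1 - taylor 0 r u (m, 1) = weight r (m, 1) * (1 - taylor 0 r u (q - 1, 1))" for m
    using taylor_eq[OF assms, of 0 u "(m, 1)"] b[of m] by (simp add: source_def step_def algebra_simps)
  have "weight r (q - 1, 1) < 1" using completed_less_1[OF assms] by (simp add: weight_def)
  then have "1 - taylor 0 r u (q - 1, 1) = 0" using e[of "q - 1"] by auto
  then show ?thesis using e[of n] by simp
qed

text \<open>The first component enters only as an exponent of \<open>\<sigma>\<close>, and
  \<open>step\<close> forgets it. This allows a full cell number and its last digit to be
  exchanged.\<close>

lemma taylor_state_mod: "taylor n r u (m mod q, y) = taylor n r u (m, y)" if "admissible q r"
proof -
  have "weight r (m mod q, y) = weight r (m, y)" "source n r u (m mod q, y) = source n r u (m, y)"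
    by (auto simp: weight_def source_def \<sigma>_power_mod base_def dbase_def dweight_def step_def
        split: nat.split)
  then show ?thesis
    using taylor_eq[OF that, of n u "(m mod q, y)"] taylor_eq[OF that, of n u "(m, y)"]
    by (simp add: step_def)
qed


subsection \<open>The q-adic sigma-field\<close>

text \<open>The empty set is included to make the family closed under intersection, as uniqueness of
  measures on a generator requires.\<close>

definition cells :: "real set set" where
  "cells = insert {} (\<Union>k. I q k ` {..<q ^ k})"

lemma cells_subset: "cells \<subseteq> Pow {0..1}"
  using I_subset by (auto simp: cells_def)

lemma full_field_eq: "full_field q = sigma_sets {0..1} cells"
proof
  interpret sigma_algebra "{0..1}" "sigma_sets {0..1} cells"
    by (rule sigma_algebra_sigma_sets[OF cells_subset])
  have "level_field q k \<subseteq> sigma_sets {0..1} cells" for k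
    unfolding level_field_def by (rule sigma_sets_subset) (auto simp: cells_def)
  then show "full_field q \<subseteq> sigma_sets {0..1} cells"
    unfolding full_field_def by (intro sigma_sets_subset) auto
  have "cells \<subseteq> full_field q"
    unfolding full_field_def level_field_def cells_def by (auto intro: sigma_sets.intros(1,2))
  then show "sigma_sets {0..1} cells \<subseteq> full_field q"
    unfolding full_field_def by (intro sigma_sets_mono) (simp add: full_field_def)
qed

lemma I_in_full_field: "n < q ^ k \<Longrightarrow> I q k n \<in> full_field q"
  unfolding full_field_eq by (auto simp: cells_def intro!: sigma_sets.Basic)

lemma sigma_algebra_full_field: "sigma_algebra {0..1} (full_field q)"
  unfolding full_field_eq by (rule sigma_algebra_sigma_sets[OF cells_subset])

lemma full_field_subset_borel: "full_field q \<subseteq> sets borel"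
proof -
  have "I q k n \<in> sets borel" for k n by (simp add: I_def)
  then have "cells \<subseteq> sets borel" by (auto simp: cells_def)
  moreover have "{0..1::real} \<in> sets borel" by simp
  ultimately have "sigma_sets {0..1} cells \<subseteq> sets borel"
    using sets.sigma_sets_subset'[of cells borel "{0..1}"] by simp
  then show ?thesis unfolding full_field_eq .
qed

lemma I_Suc_subset:
  assumes "n < q ^ (k + m)"
  shows "I q (k + m) n \<subseteq> I q k (n div q ^ m)"
proof
  fix x assume x: "x \<in> I q (k + m) n"
  have x01: "0 \<le> x" "x \<le> 1" using I_subset[OF assms] x by auto
  have c: "cell (k + m) x = n" using x mem_I_iff_cell[OF x01 assms] by simp
  have "cell (k + m) x div q ^ m = cell k x" for m
  proof (induction m)
    case (Suc m)
    have "cell (k + Suc m) x div q ^ Suc m = (cell (Suc (k + m)) x div q) div q ^ m"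
      by (simp add: div_mult2_eq)
    then show ?case using Suc cell_Suc_div[OF x01] by simp
  qed simp
  then show "x \<in> I q k (n div q ^ m)" using mem_I_cell[OF x01, of k] c by auto
qed

lemma disjoint_I:
  assumes "m < q ^ k" "n < q ^ k" "m \<noteq> n"
  shows "I q k m \<inter> I q k n = {}"
proof (rule ccontr)
  assume "I q k m \<inter> I q k n \<noteq> {}"
  then obtain x where x: "x \<in> I q k m" "x \<in> I q k n" by blast
  then have "0 \<le> x" "x \<le> 1" using I_subset[OF assms(1)] by auto
  then show False using x assms mem_I_iff_cell by metis
qed

text \<open>Two cells are nested or disjoint, according to whether the coarser one is the ancestor
  of the finer one.\<close>

lemma Int_stable_cells: "Int_stable cells"
proof -
  have *: "I q k a \<inter> I q (k + m) b \<in> cells" if "a < q ^ k" "b < q ^ (k + m)" for k m a b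
  proof (cases "b div q ^ m = a")
    case True
    then have "I q k a \<inter> I q (k + m) b = I q (k + m) b" using I_Suc_subset[OF that(2)] by auto
    then show ?thesis using that by (auto simp: cells_def)
  next
    case False
    have "b div q ^ m < q ^ k" using that by (simp add: less_mult_imp_div_less power_add)
    then have "I q k a \<inter> I q (k + m) b = {}"
      using I_Suc_subset[OF that(2)] disjoint_I[of "b div q ^ m" k a] that False by auto
    then show ?thesis by (simp add: cells_def)
  qed
  have "I q k a \<inter> I q l b \<in> cells" if "a < q ^ k" "b < q ^ l" for k l a b
    using *[of a k b "l - k"] *[of b l a "k - l"] that
    by (cases "k \<le> l") (auto simp: Int_commute)
  then show ?thesis unfolding Int_stable_def cells_def by auto
qed

text \<open>At each level, take all cells up to the one containing x. The intersection over the
  levels leaves nothing to the right of x, by \<open>cells_separate\<close>.\<close>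

lemma Icc_in_full_field:
  assumes "0 \<le> x" "x \<le> 1"
  shows "{0..x} \<in> full_field q"
proof -
  interpret sigma_algebra "{0..1}" "full_field q" by (rule sigma_algebra_full_field)
  have "{0..x} = (\<Inter>k. \<Union>n\<le>cell (Suc k) x. I q (Suc k) n)"
  proof (intro equalityI subsetI)
    fix y assume "y \<in> {0..x}"
    then have y: "0 \<le> y" "y \<le> 1" "y \<le> x" using assms by auto
    then show "y \<in> (\<Inter>k. \<Union>n\<le>cell (Suc k) x. I q (Suc k) n)"
      using mem_I_cell cell_mono[OF y(3)] by blast
  next
    fix y assume y: "y \<in> (\<Inter>k. \<Union>n\<le>cell (Suc k) x. I q (Suc k) n)"
    have le: "n < q ^ k" if "n \<le> cell k x" for n k using that cell_less[of k x] by linarith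
    obtain n\<^sub>0 where "n\<^sub>0 \<le> cell (Suc 0) x" "y \<in> I q (Suc 0) n\<^sub>0" using y by blast
    then have "y \<in> {0..1}" using I_subset[OF le] by blast
    then have y01: "0 \<le> y" "y \<le> 1" by auto
    have "y \<le> x"
    proof (rule ccontr)
      assume "\<not> y \<le> x"
      then obtain k where k: "cell (Suc k) x < cell (Suc k) y"
        using cells_separate[of x y] assms y01 by auto
      obtain n where n: "n \<le> cell (Suc k) x" "y \<in> I q (Suc k) n" using y by blast
      then have "cell (Suc k) y = n" using mem_I_iff_cell[OF y01] le[OF n(1)] by blast
      then show False using n k by simp
    qed
    then show "y \<in> {0..x}" using y01 by simp
  qed
  moreover have "(\<Union>n\<le>cell (Suc k) x. I q (Suc k) n) \<in> full_field q" for k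
    by (intro finite_UN finite_atMost I_in_full_field) (metis atMost_iff cell_less le_less_trans)
  ultimately show ?thesis by auto
qed


subsection \<open>Existence and uniqueness of the measure\<close>

text \<open>The mass prescribed for cell n of level k + 1. The shift of the index comes from
  \<open>d\<close> acting at level one, below the single cell of level zero.\<close>

fun mass :: "(nat \<Rightarrow> real) \<Rightarrow> (nat \<Rightarrow> real) \<Rightarrow> nat \<Rightarrow> nat \<Rightarrow> real" where
  "mass d r 0 n = completed q d n"
| "mass d r (Suc k) n = mass d r k (n div q) * completed q r ((\<sigma> ^^ (n div q)) (n mod q))"

lemma measure_I_eq_mass:
  assumes "is_multinomial q \<sigma> d r M" "n < q ^ Suc k"
  shows "measure M (I q (Suc k) n) = mass d r k n"
  using assms(2)
proof (induction k arbitrary: n)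
  case 0
  then show ?case using assms(1) by (simp add: is_multinomial_def)
next
  case (Suc k)
  have j: "n div q < q ^ Suc k" using Suc.prems by (simp add: less_mult_imp_div_less mult.commute)
  have *: "measure M (I q k (q * j + l)) = measure M (I q (k - 1) j) * completed q r ((\<sigma> ^^ j) l)"
    if "2 \<le> k" "j < q ^ (k - 1)" "l < q" for k j l
    using assms(1) that by (simp add: is_multinomial_def)
  have "measure M (I q (Suc (Suc k)) (q * (n div q) + n mod q)) =
      measure M (I q (Suc (Suc k) - 1) (n div q)) * completed q r ((\<sigma> ^^ (n div q)) (n mod q))"
    using j by (intro *) auto
  then show ?case using Suc.IH[OF j] by simp
qed

lemma is_multinomialI:
  assumes "prob_space M" "space M = {0..1}" "sets M = full_field q"
    and "\<And>k n. n < q ^ Suc k \<Longrightarrow> measure M (I q (Suc k) n) = mass d r k n"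
  shows "is_multinomial q \<sigma> d r M"
  unfolding is_multinomial_def
proof (intro conjI allI impI assms(1-3))
  fix n assume "n < q"
  then show "measure M (I q 1 n) = completed q d n" using assms(4)[of n 0] by simp
next
  fix k j l :: nat assume k: "2 \<le> k" and j: "j < q ^ (k - 1)" and l: "l < q"
  define i where "i = k - 2"
  have i: "k = Suc (Suc i)" using k by (simp add: i_def)
  have "q * j + l < q * (j + 1)" using l by simp
  also have "\<dots> \<le> q * q ^ Suc i" using j i by (intro mult_le_mono2) simp
  finally have "q * j + l < q ^ Suc (Suc i)" by simp
  then have "measure M (I q k (q * j + l)) = mass d r (Suc i) (q * j + l)" using assms(4) i by simp
  also have "\<dots> = mass d r i j * completed q r ((\<sigma> ^^ j) l)" using l by simp
  finally show "measure M (I q k (q * j + l)) = measure M (I q (k - 1) j) * completed q r ((\<sigma> ^^ j) l)"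
    using assms(4)[of j i] j i by simp
qed

lemma is_multinomial_unique:
  assumes "is_multinomial q \<sigma> d r M" "is_multinomial q \<sigma> d r N"
  shows "M = N"
proof (rule measure_eqI_generator_eq[OF Int_stable_cells cells_subset, where A = "\<lambda>_. {0..1}"])
  interpret M: prob_space M using assms(1) by (simp add: is_multinomial_def)
  interpret N: prob_space N using assms(2) by (simp add: is_multinomial_def)
  show "sets M = sigma_sets {0..1} cells" "sets N = sigma_sets {0..1} cells"
    using assms by (auto simp: is_multinomial_def full_field_eq)
  have sp: "space M = {0..1}" "space N = {0..1}" using assms by (auto simp: is_multinomial_def)
  have I0: "I q 0 0 = {0..1}" by (simp add: I_def)
  then show "range (\<lambda>_. {0..1}) \<subseteq> cells" by (force simp: cells_def)
  show "(\<Union>i::nat. {0..1::real}) = {0..1}" by simp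
  show "emeasure M {0..1} \<noteq> \<infinity>" by simp
  fix X assume "X \<in> cells"
  then consider "X = {}" | k n where "n < q ^ k" "X = I q k n" by (auto simp: cells_def)
  then show "emeasure M X = emeasure N X"
  proof cases
    case 2
    show ?thesis
    proof (cases k)
      case 0
      then show ?thesis using 2 I0 M.emeasure_space_1 N.emeasure_space_1 sp by simp
    next
      case (Suc i)
      then show ?thesis using measure_I_eq_mass[OF assms(1)] measure_I_eq_mass[OF assms(2)] 2
        by (simp add: M.emeasure_eq_measure N.emeasure_eq_measure)
    qed
  qed simp
qed

section \<open>Cumulative masses and the distribution function\<close>

lemma sum_lessThan_mult: "(\<Sum>n<q * j. f n) = (\<Sum>i<j. \<Sum>l<q. f (q * i + l))" for f :: "nat \<Rightarrow> real"
proof (induction j)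
  case (Suc j)
  have "(\<Sum>n<q * j + l. f n) = (\<Sum>n<q * j. f n) + (\<Sum>i<l. f (q * j + i))" for l
    by (induction l) simp_all
  then show ?case using Suc by (simp add: add.commute)
qed simp

definition cumulative :: "(nat \<Rightarrow> real) \<Rightarrow> (nat \<Rightarrow> real) \<Rightarrow> nat \<Rightarrow> nat \<Rightarrow> real" where
  "cumulative d r k n = (\<Sum>i<n. mass d r k i)"

text \<open>The prospective mass of [0, x]. The vector \<open>d\<close> governs the first digit
  only; all later digits follow \<open>r\<close> and are covered by the coefficient of degree
  zero.\<close>

definition distr_fun :: "(nat \<Rightarrow> real) \<Rightarrow> (nat \<Rightarrow> real) \<Rightarrow> real \<Rightarrow> real" where
  "distr_fun d r x = (\<Sum>m<digit x. completed q d m) +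
     completed q d (digit x) * taylor 0 r (\<lambda>_. 0) (digit x, shift q x)"

context
  fixes d r :: "nat \<Rightarrow> real"
  assumes d: "admissible q d" and r: "admissible q r"
begin

lemma mass_nonneg: "n < q ^ Suc k \<Longrightarrow> 0 \<le> mass d r k n"
proof (induction k arbitrary: n)
  case 0
  then show ?case using d by (simp add: completed_pos less_imp_le)
next
  case (Suc k)
  have j: "n div q < q ^ Suc k" using Suc.prems by (simp add: less_mult_imp_div_less mult.commute)
  have "0 < completed q r ((\<sigma> ^^ (n div q)) (n mod q))" using r by (intro completed_pos) auto
  then show ?case using Suc.IH[OF j] by simp
qed

text \<open>Masses decay geometrically with the level, uniformly over the cells. This is the source
  of continuity of the distribution function.\<close>

lemma mass_tendsto_0:
  assumes "0 < \<epsilon>"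
  obtains k where "\<And>n. n < q ^ Suc k \<Longrightarrow> mass d r k n < \<epsilon>"
proof -
  obtain \<rho> where \<rho>: "0 < \<rho>" "\<rho> < 1" "\<And>j. j < q \<Longrightarrow> completed q r j \<le> \<rho>"
    using completed_bound[OF r] by blast
  obtain k where k: "\<rho> ^ k < \<epsilon>" using real_arch_pow_inv[OF assms \<rho>(2)] by blast
  have "mass d r k n \<le> \<rho> ^ k" if "n < q ^ Suc k" for k n
    using that
  proof (induction k arbitrary: n)
    case 0
    then show ?case using completed_less_1[OF d] by (simp add: less_imp_le)
  next
    case (Suc k)
    have j: "n div q < q ^ Suc k" using Suc.prems by (simp add: less_mult_imp_div_less mult.commute)
    have "mass d r k (n div q) * completed q r ((\<sigma> ^^ (n div q)) (n mod q)) \<le> \<rho> ^ k * \<rho>"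
      using Suc.IH[OF j] mass_nonneg[OF j] \<rho> completed_pos[OF r]
        by (intro mult_mono) (auto simp: less_imp_le)
    then show ?case by (simp add: mult.commute)
  qed
  then show ?thesis using that k by (meson le_less_trans)
qed

lemma cumulative_Suc:
  assumes "l \<le> q"
  shows "cumulative d r (Suc k) (q * j + l) =
    cumulative d r k j + mass d r k j * (\<Sum>m<l. completed q r ((\<sigma> ^^ j) m))"
proof -
  have "cumulative d r (Suc k) (q * j) = cumulative d r k j"
    unfolding cumulative_def sum_lessThan_mult
    by (simp add: sum_distrib_left[symmetric] sum_completed_perm)
  moreover have "cumulative d r (Suc k) (q * j + l) = cumulative d r (Suc k) (q * j) +
      (\<Sum>m<l. mass d r k j * completed q r ((\<sigma> ^^ j) m))" if "l \<le> q" for l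
    using that
  proof (induction l)
    case (Suc l)
    then show ?case by (simp add: cumulative_def)
  qed simp
  ultimately show ?thesis using assms by (simp add: sum_distrib_left)
qed

text \<open>The transfer equation unrolled k times. After each step \<open>taylor_state_mod\<close>
  turns the last digit back into the full cell number, so that the induction can continue.\<close>

lemma distr_fun_eq:
  assumes "0 \<le> x" "x \<le> 1"
  shows "distr_fun d r x = cumulative d r k (cell (Suc k) x) +
    mass d r k (cell (Suc k) x) * taylor 0 r (\<lambda>_. 0) (cell (Suc k) x, (shift q ^^ Suc k) x)"
proof (induction k)
  case 0
  then show ?case by (simp add: distr_fun_def cumulative_def digit_def)
next
  case (Suc k)
  let ?c = "cell (Suc k) x" and ?y = "(shift q ^^ Suc k) x"
  let ?l = "digit ?y"
  have c: "cell (Suc (Suc k)) x = q * ?c + ?l" using cell_Suc[OF assms, of "Suc k"] .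
  have t: "taylor 0 r (\<lambda>_. 0) (?c, ?y) = base r (?c, ?y) + weight r (?c, ?y) *
    taylor 0 r (\<lambda>_. 0) (?l, shift q ?y)"
    using taylor_eq[OF r, of 0 "\<lambda>_. 0" "(?c, ?y)"] by (simp add: source_def step_def)
  have s: "taylor 0 r (\<lambda>_. 0) (?l, shift q ?y) = taylor 0 r (\<lambda>_. 0) (q * ?c + ?l, shift q ?y)"
    using taylor_state_mod[OF r, of 0 "\<lambda>_. 0" "q * ?c + ?l"] by simp
  have cum: "cumulative d r (Suc k) (q * ?c + ?l) = cumulative d r k ?c + mass d r k ?c * base r (?c, ?y)"
    unfolding cumulative_Suc[OF less_imp_le[OF digit_less]] by (simp add: base_def)
  have ms: "mass d r (Suc k) (q * ?c + ?l) = mass d r k ?c * weight r (?c, ?y)"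
    by (simp add: weight_def)
  show ?case unfolding Suc c cum ms t s by (simp add: algebra_simps)
qed

lemma cumulative_mono: "m \<le> n \<Longrightarrow> n \<le> q ^ Suc k \<Longrightarrow> cumulative d r k m \<le> cumulative d r k n"
  unfolding cumulative_def by (intro sum_mono2) (auto intro: mass_nonneg)

lemma distr_fun_bounds:
  assumes "0 \<le> x" "x \<le> 1"
  shows "cumulative d r k (cell (Suc k) x) \<le> distr_fun d r x"
    "distr_fun d r x \<le> cumulative d r k (Suc (cell (Suc k) x))"
proof -
  let ?c = "cell (Suc k) x"
  let ?t = "taylor 0 r (\<lambda>_. 0) (?c, (shift q ^^ Suc k) x)"
  have "0 \<le> ?t" "?t \<le> 1" "0 \<le> mass d r k ?c"
    using taylor_0_nonneg[OF r] taylor_0_le_1[OF r] mass_nonneg[OF cell_less] by blast+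
  then have "0 \<le> mass d r k ?c * ?t" "mass d r k ?c * ?t \<le> mass d r k ?c"
    using mult_left_le[of ?t "mass d r k ?c"] by auto
  then show "cumulative d r k ?c \<le> distr_fun d r x" "distr_fun d r x \<le> cumulative d r k (Suc ?c)"
    unfolding distr_fun_eq[OF assms, of k] by (simp_all add: cumulative_def)
qed

lemma distr_fun_grid:
  assumes "n \<le> q ^ Suc k"
  shows "distr_fun d r (real n / real q ^ Suc k) = cumulative d r k n"
proof (cases "n = q ^ Suc k")
  \<comment> \<open>The point 1 is not the left end of a cell: it sits in the last cell at relative
    position 1, where the coefficient of degree zero is 1 instead of 0.\<close>
  case True
  have x: "real n / real q ^ Suc k = 1" using True by simp
  have "0 < q ^ Suc k" by simp
  then obtain p where p: "q ^ Suc k = Suc p" using gr0_implies_Suc by blast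
  have "distr_fun d r 1 = cumulative d r k p + mass d r k p"
    using distr_fun_eq[of 1 k] unfolding shift_pow_1 taylor_0_at_1[OF r] cell_1_right p by simp
  then show ?thesis unfolding x using True p by (simp add: cumulative_def del: power_Suc)
next
  case False
  then have n: "n < q ^ Suc k" using assms by linarith
  have "real n \<le> real q ^ Suc k" using of_nat_mono[OF assms, where 'a = real] by (simp only: of_nat_power)
  moreover have "0 < real q ^ Suc k" by simp
  ultimately have x: "0 \<le> real n / real q ^ Suc k" "real n / real q ^ Suc k \<le> 1"
    by (simp_all only: divide_le_eq_1_pos zero_le_divide_iff of_nat_0_le_iff less_imp_le) simp
  show ?thesis using distr_fun_eq[OF x, of k] unfolding cell_grid[OF n] taylor_0_at_0[OF r] by simp
qed

lemma distr_fun_0: "distr_fun d r 0 = 0" and distr_fun_1: "distr_fun d r 1 = 1"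
proof -
  show "distr_fun d r 0 = 0" using distr_fun_grid[of 0 0] by (simp add: cumulative_def)
  show "distr_fun d r 1 = 1" using distr_fun_grid[of q 0] by (simp add: cumulative_def sum_completed)
qed

lemma distr_fun_mono:
  assumes "0 \<le> x" "x \<le> y" "y \<le> 1"
  shows "distr_fun d r x \<le> distr_fun d r y"
proof (cases "x = y")
  case False
  then obtain k where k: "cell (Suc k) x < cell (Suc k) y" using cells_separate[of x y] assms by auto
  have "distr_fun d r x \<le> cumulative d r k (Suc (cell (Suc k) x))" using distr_fun_bounds assms by auto
  also have "\<dots> \<le> cumulative d r k (cell (Suc k) y)"
    using k by (intro cumulative_mono less_imp_le[OF cell_less]) simp
  also have "\<dots> \<le> distr_fun d r y" using distr_fun_bounds assms by auto
  finally show ?thesis .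
qed simp

text \<open>Points closer than one cell width lie in equal or neighbouring cells, so the increment
  is at most two cell masses, each below epsilon / 2 at a suitable level.\<close>

lemma distr_fun_continuous: "continuous_on {0..1} (distr_fun d r)"
proof -
  have near: "\<exists>\<delta>>0. \<forall>x y. 0 \<le> x \<and> x \<le> y \<and> y \<le> 1 \<and> y - x < \<delta> \<longrightarrow> distr_fun d r y - distr_fun d r x < \<epsilon>"
    if \<epsilon>: "0 < \<epsilon>" for \<epsilon>
  proof -
    obtain k where k: "\<And>n. n < q ^ Suc k \<Longrightarrow> mass d r k n < \<epsilon> / 2"
      using mass_tendsto_0[of "\<epsilon> / 2"] \<epsilon> by auto
    have "distr_fun d r y - distr_fun d r x < \<epsilon>"
      if xy: "0 \<le> x" "x \<le> y" "y \<le> 1" and close: "y - x < 1 / real q ^ Suc k" for x y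
    proof -
      let ?a = "cell (Suc k) x" and ?b = "cell (Suc k) y"
      have x1: "0 \<le> x" "x \<le> 1" and y1: "0 \<le> y" "y \<le> 1" using xy by auto
      have "real q ^ Suc k * (y - x) < 1" using close by (simp add: field_simps)
      then have "real q ^ Suc k * y < real q ^ Suc k * x + 1" by (simp add: algebra_simps)
      then have "real ?b < real ?a + 2" using cell_le[OF y1, of "Suc k"] le_cell[OF x1, of "Suc k"]
        by linarith
      then have ba: "?b \<le> Suc ?a" "?a \<le> ?b" using cell_mono[OF xy(2)] by auto
      have "distr_fun d r y - distr_fun d r x \<le> cumulative d r k (Suc ?b) - cumulative d r k ?a"
        using distr_fun_bounds(1)[OF x1, of k] distr_fun_bounds(2)[OF y1, of k] by linarith
      also have "\<dots> \<le> mass d r k ?a + mass d r k ?b"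
      proof (cases "?b = ?a")
        case True
        then show ?thesis using mass_nonneg[OF cell_less, of k x] by (simp add: cumulative_def)
      next
        case False
        then have "?b = Suc ?a" using ba by simp
        then show ?thesis by (simp add: cumulative_def)
      qed
      also have "\<dots> < \<epsilon>" using k[OF cell_less, of x] k[OF cell_less, of y] by simp
      finally show ?thesis .
    qed
    then show ?thesis by (intro exI[of _ "1 / real q ^ Suc k"]) auto
  qed
  show ?thesis unfolding continuous_on_iff
  proof (intro ballI allI impI)
    fix x \<epsilon> :: real assume x: "x \<in> {0..1}" and "0 < \<epsilon>"
    then obtain \<delta> where \<delta>: "0 < \<delta>"
      "\<And>x y. 0 \<le> x \<Longrightarrow> x \<le> y \<Longrightarrow> y \<le> 1 \<Longrightarrow> y - x < \<delta> \<Longrightarrow> distr_fun d r y - distr_fun d r x < \<epsilon>"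
      using near by meson
    have "dist (distr_fun d r y) (distr_fun d r x) < \<epsilon>" if y: "y \<in> {0..1}" "dist y x < \<delta>" for y
    proof (cases "x \<le> y")
      case True
      then show ?thesis using \<delta>(2)[of x y] distr_fun_mono[of x y] x y by (auto simp: dist_real_def)
    next
      case False
      then show ?thesis using \<delta>(2)[of y x] distr_fun_mono[of y x] x y by (auto simp: dist_real_def)
    qed
    then show "\<exists>\<delta>>0. \<forall>y\<in>{0..1}. dist y x < \<delta> \<longrightarrow> dist (distr_fun d r y) (distr_fun d r x) < \<epsilon>"
      using \<delta>(1) by blast
  qed
qed

lemma ex_multinomial:
  "\<exists>M. is_multinomial q \<sigma> d r M \<and> (\<forall>x\<in>{0..1}. measure M {0..x} = distr_fun d r x)"
proof -
  \<comment> \<open>Clamping the argument extends the function to a monotone continuous one on the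
    whole line, as the Stieltjes construction requires.\<close>
  define F where "F x = distr_fun d r (max 0 (min 1 x))" for x
  have F_mono: "F x \<le> F y" if "x \<le> y" for x y
    unfolding F_def using that by (intro distr_fun_mono) auto
  have F_cont: "continuous_on UNIV F"
  proof -
    have "continuous_on UNIV (\<lambda>x::real. max 0 (min 1 x))" by (intro continuous_intros)
    moreover have "continuous_on ((\<lambda>x::real. max 0 (min 1 x)) ` UNIV) (distr_fun d r)"
      by (rule continuous_on_subset[OF distr_fun_continuous]) auto
    ultimately show ?thesis
      unfolding F_def[abs_def] using continuous_on_compose[of UNIV] by (simp add: o_def)
  qed
  \<comment> \<open>The Stieltjes measure lives on the Borel sets of the line; it is cut down to
    [0, 1] and then to the q-adic field, because \<open>is_multinomial\<close> prescribes space and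
    sets exactly.\<close>
  define R where "R = restrict_space (interval_measure F) {0..1}"
  define M where "M = restr_to_subalg R (sigma {0..1} (full_field q))"
  have Icc: "emeasure (interval_measure F) {a..b} = ennreal (F b - F a)" if "a \<le> b" for a b
    using that by (rule emeasure_interval_measure_Icc[OF _ F_mono F_cont])
  have Ico: "emeasure (interval_measure F) {a..<b} = ennreal (F b - F a)" if "a \<le> b" for a b
  proof -
    \<comment> \<open>Single points have measure zero by continuity of \<open>F\<close>.\<close>
    have "emeasure (interval_measure F) ({a..b} - {b..b}) = ennreal (F b - F a) - 0"
      using that Icc[of a b] Icc[of b b] by (subst emeasure_Diff) auto
    moreover have "{a..b} - {b..b} = {a..<b}" by auto
    ultimately show ?thesis by simp
  qed
  have sets_sigma: "sets (sigma {0..1} (full_field q)) = full_field q"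
    "space (sigma {0..1} (full_field q)) = {0..1}"
    using sigma_algebra.sets_measure_of_eq[OF sigma_algebra_full_field]
      sigma_algebra.space_measure_of_eq[OF sigma_algebra_full_field] by auto
  have sub: "subalgebra R (sigma {0..1} (full_field q))"
  proof -
    have "A \<in> sets R" if A: "A \<in> full_field q" for A
    proof -
      have "A \<subseteq> {0..1}" using A sigma_sets_into_sp[OF cells_subset] unfolding full_field_eq by blast
      then show ?thesis using A full_field_subset_borel
        by (auto simp: R_def sets_restrict_space_iff)
    qed
    then show ?thesis unfolding subalgebra_def sets_sigma by (auto simp: R_def space_restrict_space)
  qed
  have sp: "space M = {0..1}" and st: "sets M = full_field q"
    unfolding M_def using sub sets_sigma
      by (auto simp: space_restr_to_subalg sets_restr_to_subalg R_def space_restrict_space)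
  have em: "emeasure M A = emeasure (interval_measure F) A" if A: "A \<in> full_field q" for A
  proof -
    have "A \<subseteq> {0..1}" using A sigma_sets_into_sp[OF cells_subset] unfolding full_field_eq by blast
    then have "emeasure R A = emeasure (interval_measure F) A"
      unfolding R_def by (intro emeasure_restrict_space) auto
    then show ?thesis unfolding M_def using emeasure_restr_to_subalg[OF sub] A sets_sigma by simp
  qed
  have M_Icc: "measure M {0..x} = distr_fun d r x" if "x \<in> {0..1}" for x
  proof -
    have "F x - F 0 = distr_fun d r x" using that distr_fun_0 by (simp add: F_def)
    moreover have "0 \<le> distr_fun d r x" using that distr_fun_mono[of 0 x] distr_fun_0 by simp
    ultimately show ?thesis using that em[OF Icc_in_full_field] Icc[of 0 x] by (simp add: measure_def)
  qed
  have "is_multinomial q \<sigma> d r M"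
  proof (rule is_multinomialI)
    show "prob_space M"
    proof
      have "emeasure M {0..1} = ennreal (F 1 - F 0)"
        using em[OF Icc_in_full_field[of 1]] Icc[of 0 1] by simp
      then show "emeasure M (space M) = 1" unfolding sp by (simp add: F_def distr_fun_0 distr_fun_1)
    qed
    fix k n assume n: "n < q ^ Suc k"
    let ?a = "real n / real q ^ Suc k" and ?b = "real (Suc n) / real q ^ Suc k"
    have "real (Suc n) \<le> real (q ^ Suc k)" using n by (intro of_nat_mono) simp
    then have b1: "?b \<le> 1" by (simp add: divide_simps)
    have ab: "0 \<le> ?a" "?a \<le> ?b" by (auto simp: divide_simps)
    have "F ?b - F ?a = cumulative d r k (Suc n) - cumulative d r k n"
      using ab b1 distr_fun_grid[of n k] distr_fun_grid[of "Suc n" k] n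
        by (simp add: F_def min_absorb2 max_absorb2)
    then have Fab: "F ?b - F ?a = mass d r k n" by (simp add: cumulative_def)
    have "emeasure (interval_measure F) (I q (Suc k) n) = ennreal (F ?b - F ?a)"
    proof (cases "n = q ^ Suc k - 1")
      case True
      then have "Suc n = q ^ Suc k" by simp
      then have "?b = 1" by (metis div_self of_nat_power of_nat_0_eq_iff power_not_zero q_nonzero)
      then show ?thesis using Icc[of ?a 1] True ab b1 by (simp add: I_def)
    next
      case False
      then show ?thesis using Ico[OF ab(2)] by (simp add: I_def)
    qed
    then show "measure M (I q (Suc k) n) = mass d r k n"
      unfolding Fab measure_def em[OF I_in_full_field[OF n]] using mass_nonneg[OF n] by simp
  qed (fact sp st)+
  then show ?thesis using M_Icc by blast
qed

lemma multinomial_measure_eqI: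
  assumes "is_multinomial q \<sigma> d r M"
  shows "multinomial_measure q \<sigma> d r = M"
  unfolding multinomial_measure_def
proof (rule the_equality)
  show "is_multinomial q \<sigma> d r M" by fact
  show "N = M" if "is_multinomial q \<sigma> d r N" for N using is_multinomial_unique[OF that assms] .
qed

lemma is_multinomial_multinomial_measure: "is_multinomial q \<sigma> d r (multinomial_measure q \<sigma> d r)"
proof -
  obtain M where M: "is_multinomial q \<sigma> d r M" using ex_multinomial by (elim exE conjE)
  show ?thesis unfolding multinomial_measure_eqI[OF M] by (rule M)
qed

lemma L_eq_distr_fun:
  assumes "x \<in> {0..1}"
  shows "L q \<sigma> d r x = distr_fun d r x"
proof -
  obtain M where M: "is_multinomial q \<sigma> d r M" "\<forall>x\<in>{0..1}. measure M {0..x} = distr_fun d r x"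
    using ex_multinomial by blast
  show ?thesis unfolding L_def multinomial_measure_eqI[OF M(1)] by (rule bspec[OF M(2) assms])
qed

end


subsection \<open>The Takagi functions\<close>

text \<open>The state after i steps holds the last digit of the cell of level i + 1, which fixes the
  power of \<open>\<sigma>\<close> in the next factor. The product is the one occurring in
  \<open>weighted_series\<close>.\<close>

lemma mass_cell:
  assumes "0 \<le> x" "x \<le> 1"
  shows "mass d r k (cell (Suc k) x) =
    completed q d (digit x) * (\<Prod>i<k. weight r ((step ^^ i) (digit x, shift q x)))"
proof (induction k)
  case 0
  then show ?case by (simp add: digit_def)
next
  case (Suc k)
  have "\<sigma> ^^ cell (Suc k) x = \<sigma> ^^ digit ((shift q ^^ k) x)"
    using \<sigma>_power_mod[of "cell (Suc k) x"] cell_Suc_mod[OF assms] by simp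
  then have "mass d r (Suc k) (cell (Suc (Suc k)) x) =
      mass d r k (cell (Suc k) x) * weight r ((step ^^ k) (digit x, shift q x))"
    by (simp only: mass.simps cell_Suc_div[OF assms] cell_Suc_mod[OF assms] weight_def step_pow
      fst_conv snd_conv)
  then show ?case unfolding Suc by simp
qed

section \<open>Phi and Psi in terms of digits, and the integral of Psi\<close>

lemma mult_add_eq_iff:
  assumes "b < q" "b' < q"
  shows "q * a + b = q * a' + b' \<longleftrightarrow> a = a' \<and> b = b'"
proof
  assume e: "q * a + b = q * a' + b'"
  have "(q * a + b) div q = a" "(q * a' + b') div q = a'" using assms by auto
  then have "a = a'" using e by simp
  then show "a = a' \<and> b = b'" using e by simp
qed simp

text \<open>Phi with index l marks the second-level cells whose conditional mass is
  \<open>completed q r l\<close>; each first-level cell contains exactly one of them.\<close>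

lemma Phi_eq:
  assumes "0 \<le> t" "t \<le> 1" "l < q"
  shows "Phi q \<sigma> l t = (if (\<sigma> ^^ digit t) (digit (shift q t)) = l then 1 else 0)"
proof -
  have inv_less: "(inv \<sigma> ^^ j) l < q" for j
    using \<sigma>_power_less[of j "(inv \<sigma> ^^ j) l"] assms(3) by (simp add: \<sigma>_power_inverse)
  have "indicat_real (I q 2 (q * j + (inv \<sigma> ^^ j) l)) t =
      (if j = digit t then
        if (\<sigma> ^^ digit t) (digit (shift q t)) = l then 1 else 0 else 0)" if j: "j < q" for j
  proof -
    have "q * j + (inv \<sigma> ^^ j) l < q * (j + 1)" using inv_less[of j] by simp
    also have "\<dots> \<le> q * q" using j by (intro mult_le_mono2) simp
    finally have n: "q * j + (inv \<sigma> ^^ j) l < q ^ 2" by (simp add: power2_eq_square)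
    have "cell 2 t = q * digit t + digit (shift q t)"
      using cell_Suc[OF assms(1,2), of 1] by (simp add: digit_def numeral_2_eq_2)
    moreover have "digit (shift q t) = (inv \<sigma> ^^ j) l \<longleftrightarrow> (\<sigma> ^^ j) (digit (shift q t)) = l"
      using \<sigma>_power_inverse by metis
    ultimately show ?thesis
      using indicator_I[OF assms(1,2) n] mult_add_eq_iff[OF inv_less[of j] digit_less[of "shift q t"],
        of j "digit t"]
      by auto
  qed
  then have "Phi q \<sigma> l t =
      (\<Sum>j<q. if j = digit t then if (\<sigma> ^^ digit t) (digit (shift q t)) = l then 1 else 0 else 0)"
    unfolding Phi_def by (intro sum.cong) auto
  then show ?thesis by (simp add: sum.delta)
qed

text \<open>Thus Psi is the logarithmic derivative of \<open>weight\<close> with respect to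
  \<open>r l\<close>, at the state reached after reading the first digit.\<close>

lemma Psi_eq:
  assumes "0 \<le> t" "t \<le> 1" "l < q - 1"
  shows "Psi q \<sigma> r l t = dweight l (digit t, shift q t) / weight r (digit t, shift q t)"
proof -
  have "l < q" "q - 1 < q" "l \<noteq> q - 1" using assms(3) by auto
  then show ?thesis unfolding Psi_def weight_def dweight_def dcompleted_def
    using Phi_eq[OF assms(1,2), of l] Phi_eq[OF assms(1,2), of "q - 1"] by auto
qed

lemma sum_indicator_I:
  fixes f :: "nat \<Rightarrow> real"
  assumes "0 \<le> x" "x \<le> 1"
  shows "(\<Sum>n<q ^ k. g n * indicat_real (I q k n) x * f n) = g (cell k x) * f (cell k x)"
proof -
  have "(\<Sum>n<q ^ k. g n * indicat_real (I q k n) x * f n) =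
      (\<Sum>n<q ^ k. if n = cell k x then g n * f n else 0)"
    using assms by (intro sum.cong) (auto simp: indicator_I)
  then show ?thesis by (simp add: sum.delta)
qed

lemma source_mi_unit:
  assumes "l < q - 1" "\<And>a. a < q - 1 \<Longrightarrow> u a = mi_unit l a"
  shows "source (Suc 0) r u z = dbase l z + dweight l z * taylor 0 r v (step z)"
proof -
  have "(\<Sum>a<q - 1. real (u a) * dbase a z) = (\<Sum>a<q - 1. if a = l then dbase a z else 0)"
    by (intro sum.cong) (auto simp: assms(2) mi_unit_def)
  moreover have "{a. a < q - 1 \<and> 0 < u a} = {l}" using assms by (auto simp: mi_unit_def split: if_split_asm)
  ultimately show ?thesis using assms(1) unfolding source_def nat.case by (simp add: sum.delta)
qed

context
  fixes d r :: "nat \<Rightarrow> real"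
  assumes d: "admissible q d" and r: "admissible q r"
begin

lemma measure_I:
  "n < q ^ Suc k \<Longrightarrow> measure (multinomial_measure q \<sigma> d r) (I q (Suc k) n) = mass d r k n"
  by (rule measure_I_eq_mass[OF is_multinomial_multinomial_measure[OF d r]])

text \<open>Cells before that of y are covered and cells after it are missed. The cell of y receives
  what remains of \<open>distr_fun d r y\<close> after the covered cells are subtracted.\<close>

lemma measure_Icc_Int_I2:
  assumes y: "0 \<le> y" "y \<le> 1" and n: "n < q ^ 2"
  shows "{0..y} \<inter> I q 2 n \<in> sets (multinomial_measure q \<sigma> d r)"
    "measure (multinomial_measure q \<sigma> d r) ({0..y} \<inter> I q 2 n) =
      (if n < cell 2 y then mass d r 1 n
       else if n = cell 2 y then mass d r 1 n * taylor 0 r (\<lambda>_. 0) (n, (shift q ^^ 2) y) else 0)"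
proof -
  let ?M = "multinomial_measure q \<sigma> d r"
  have M: "is_multinomial q \<sigma> d r ?M" by (rule is_multinomial_multinomial_measure[OF d r])
  then interpret prob_space ?M by (simp add: is_multinomial_def)
  have st: "sets ?M = full_field q" using M by (simp add: is_multinomial_def)
  have in_sets: "{0..y} \<in> sets ?M" "n < q ^ 2 \<Longrightarrow> I q 2 n \<in> sets ?M" for n
    unfolding st using Icc_in_full_field[OF y] I_in_full_field by auto
  then show "{0..y} \<inter> I q 2 n \<in> sets ?M" using n by auto
  have cell_I: "cell 2 t = n" if "t \<in> I q 2 n" "n < q ^ 2" for t n
    using that I_subset[of n 2] mem_I_iff_cell[of t n 2] by auto
  have below: "measure ?M ({0..y} \<inter> I q 2 n) = mass d r 1 n" if "n < cell 2 y" for n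
  proof -
    have n: "n < q ^ 2" using that cell_less[of 2 y] by linarith
    have "I q 2 n \<subseteq> {0..y}"
    proof
      fix t assume t: "t \<in> I q 2 n"
      then have "cell 2 t < cell 2 y" using cell_I n that by simp
      then have "t \<le> y" using cell_mono[of y t 2] by linarith
      then show "t \<in> {0..y}" using t I_subset[OF n] by auto
    qed
    then have "{0..y} \<inter> I q 2 n = I q 2 n" by auto
    then show ?thesis using measure_I[of n 1] n by (simp add: numeral_2_eq_2)
  qed
  have above: "measure ?M ({0..y} \<inter> I q 2 n) = 0" if "cell 2 y < n" "n < q ^ 2" for n
  proof -
    have "{0..y} \<inter> I q 2 n = {}"
      using cell_I[OF _ that(2)] cell_mono[of _ y 2] that(1) by fastforce
    then show ?thesis by simp
  qed
  have "{0..y} = (\<Union>n<q ^ 2. {0..y} \<inter> I q 2 n)"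
    using y mem_I_cell[of _ 2] cell_less[of 2] by fastforce
  then have "measure ?M {0..y} = measure ?M (\<Union>n<q ^ 2. {0..y} \<inter> I q 2 n)" by simp
  also have "\<dots> = (\<Sum>n<q ^ 2. measure ?M ({0..y} \<inter> I q 2 n))"
  proof (rule finite_measure_finite_Union)
    show "(\<lambda>n. {0..y} \<inter> I q 2 n) ` {..<q ^ 2} \<subseteq> sets ?M" using in_sets by auto
    show "disjoint_family_on (\<lambda>n. {0..y} \<inter> I q 2 n) {..<q ^ 2}"
      unfolding disjoint_family_on_def using disjoint_I[of _ 2] by fastforce
  qed simp
  also have "\<dots> = (\<Sum>n<Suc (cell 2 y). measure ?M ({0..y} \<inter> I q 2 n))"
  proof (rule sum.mono_neutral_right)
    show "{..<Suc (cell 2 y)} \<subseteq> {..<q ^ 2}" using Suc_leI[OF cell_less[of 2 y]] by auto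
  qed (use above in auto)
  also have "\<dots> = cumulative d r 1 (cell 2 y) + measure ?M ({0..y} \<inter> I q 2 (cell 2 y))"
  proof -
    have "(\<Sum>n<cell 2 y. measure ?M ({0..y} \<inter> I q 2 n)) = (\<Sum>n<cell 2 y. mass d r 1 n)"
      using below by (intro sum.cong) auto
    then show ?thesis by (simp only: cumulative_def sum.lessThan_Suc)
  qed
  finally have "distr_fun d r y = cumulative d r 1 (cell 2 y) + measure ?M ({0..y} \<inter> I q 2 (cell 2 y))"
    using L_eq_distr_fun[OF d r, of y] y by (simp add: L_def)
  then have "measure ?M ({0..y} \<inter> I q 2 (cell 2 y)) =
      mass d r 1 (cell 2 y) * taylor 0 r (\<lambda>_. 0) (cell 2 y, (shift q ^^ 2) y)"
    using distr_fun_eq[OF d r y, of 1] by (simp add: numeral_2_eq_2)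
  then show "measure ?M ({0..y} \<inter> I q 2 n) =
      (if n < cell 2 y then mass d r 1 n
       else if n = cell 2 y then mass d r 1 n * taylor 0 r (\<lambda>_. 0) (n, (shift q ^^ 2) y) else 0)"
    using below above n by auto
qed

text \<open>Over each complete first-level cell the integral vanishes because the entries of a completed
  vector have constant sum.\<close>

lemma integral_Psi:
  assumes y: "0 \<le> y" "y \<le> 1" and l: "l < q - 1"
  shows "(LINT t:{0..y}|multinomial_measure q \<sigma> d r. Psi q \<sigma> r l t) =
    completed q d (digit y) * source (Suc 0) r (mi_unit l) (digit y, shift q y)"
proof -
  let ?M = "multinomial_measure q \<sigma> d r"
  have M: "is_multinomial q \<sigma> d r ?M" by (rule is_multinomial_multinomial_measure[OF d r])
  then interpret prob_space ?M by (simp add: is_multinomial_def)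
  have sp: "space ?M = {0..1}" using M by (simp add: is_multinomial_def)
  \<comment> \<open>The constant value of Psi on the n-th cell of level two. The mass of that cell
    cancels the denominator.\<close>
  define c where "c n =
    dcompleted l ((\<sigma> ^^ (n div q)) (n mod q)) / completed q r ((\<sigma> ^^ (n div q)) (n mod q))" for n
  let ?\<tau> = "taylor 0 r (\<lambda>_. 0) (cell 2 y, (shift q ^^ 2) y)"
  have c_mass: "c n * mass d r 1 n = completed q d (n div q) *
    dcompleted l ((\<sigma> ^^ (n div q)) (n mod q))" for n
  proof -
    have "0 < completed q r ((\<sigma> ^^ (n div q)) (n mod q))" by (rule completed_pos[OF r]) simp
    then show ?thesis by (simp add: c_def)
  qed
  have cell2: "cell 2 t = q * digit t + digit (shift q t)" if "0 \<le> t" "t \<le> 1" for t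
    using cell_Suc[OF that, of 1] by (simp add: digit_def numeral_2_eq_2)
  have "(LINT t:{0..y}|?M. Psi q \<sigma> r l t) =
      (\<integral>t. (\<Sum>n<q ^ 2. c n * indicat_real ({0..y} \<inter> I q 2 n) t) \<partial>?M)"
    unfolding set_lebesgue_integral_def
  proof (rule Bochner_Integration.integral_cong[OF refl])
    fix t assume "t \<in> space ?M"
    then have t: "0 \<le> t" "t \<le> 1" using sp by auto
    have "(\<Sum>n<q ^ 2. c n * indicat_real ({0..y} \<inter> I q 2 n) t) =
        (\<Sum>n<q ^ 2. indicat_real {0..y} t * indicat_real (I q 2 n) t * c n)"
      by (intro sum.cong) (auto simp: indicator_def)
    also have "\<dots> = indicat_real {0..y} t * c (cell 2 t)" by (rule sum_indicator_I[OF t])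
    also have "c (cell 2 t) = Psi q \<sigma> r l t"
      unfolding cell2[OF t] Psi_eq[OF t l] c_def dweight_def weight_def by simp
    finally show "indicat_real {0..y} t *\<^sub>R Psi q \<sigma> r l t = (\<Sum>n<q ^ 2. c n *
      indicat_real ({0..y} \<inter> I q 2 n) t)"
      by simp
  qed
  also have "\<dots> = (\<Sum>n<q ^ 2. c n * measure ?M ({0..y} \<inter> I q 2 n))"
    by (subst Bochner_Integration.integral_sum)
       (auto simp: measure_Icc_Int_I2(1)[OF y] emeasure_eq_measure intro!: integrable_real_indicator)
  also have "\<dots> = (\<Sum>n<Suc (cell 2 y). c n * measure ?M ({0..y} \<inter> I q 2 n))"
  proof (rule sum.mono_neutral_right)
    show "{..<Suc (cell 2 y)} \<subseteq> {..<q ^ 2}" using Suc_leI[OF cell_less[of 2 y]] by auto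
  qed (use measure_Icc_Int_I2(2)[OF y] in auto)
  also have "\<dots> = (\<Sum>n<cell 2 y. c n * mass d r 1 n) + c (cell 2 y) * mass d r 1 (cell 2 y) * ?\<tau>"
  proof -
    have "n < q ^ 2" if "n \<le> cell 2 y" for n using that cell_less[of 2 y] by linarith
    then show ?thesis using measure_Icc_Int_I2(2)[OF y] by simp
  qed
  also have "(\<Sum>n<cell 2 y. c n * mass d r 1 n) = completed q d (digit y) * dbase l (digit y, shift q y)"
  proof -
    have split: "(\<Sum>n<q * j + m. f n) = (\<Sum>n<q * j. f n) + (\<Sum>i<m. f (q * j + i))"
      for j m and f :: "nat \<Rightarrow> real"
      by (induction m) simp_all
    have row: "(\<Sum>i<m. completed q d ((q * j + i) div q) * dcompleted l ((\<sigma> ^^ ((q * j +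
      i) div q)) ((q * j + i) mod q)))
        = completed q d j * (\<Sum>i<m. dcompleted l ((\<sigma> ^^ j) i))" if "m \<le> q" for j m
      unfolding sum_distrib_left using that by (intro sum.cong) auto
    have m: "digit (shift q y) \<le> q" using digit_less[of "shift q y"] by (rule less_imp_le)
    show ?thesis unfolding c_mass cell2[OF y] split sum_lessThan_mult row[OF order_refl] row[OF m]
      by (simp add: sum_dcompleted_perm[OF l] dbase_def)
  qed
  also have "c (cell 2 y) * mass d r 1 (cell 2 y) * ?\<tau> =
      completed q d (digit y) * (dweight l (digit y, shift q y) *
        taylor 0 r (\<lambda>_. 0) (step (digit y, shift q y)))"
  proof -
    have "taylor 0 r (\<lambda>_. 0) (cell 2 y mod q, (shift q ^^ 2) y) = ?\<tau>" by (rule taylor_state_mod[OF r])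
    moreover have "cell 2 y mod q = digit (shift q y)" "cell 2 y div q = digit y"
      unfolding cell2[OF y] by simp_all
    ultimately show ?thesis unfolding c_mass by (simp add: dweight_def step_def numeral_2_eq_2)
  qed
  finally show ?thesis
    unfolding source_mi_unit[OF l refl, of r _ "\<lambda>_. 0"] by (simp add: algebra_simps)
qed

end

lemma suminf_weighted_source:
  assumes "admissible q r"
  shows "(\<Sum>k. c * ((\<Prod>i<k. weight r ((step ^^ i) z)) * source n r u ((step ^^ k) z))) = c * taylor n r u z"
proof -
  obtain \<rho> where \<rho>: "0 < \<rho>" "\<rho> < 1" "\<And>z. 0 \<le> weight r z" "\<And>z. weight r z \<le> \<rho>"
    by (rule weight_bound[OF assms]) blast
  obtain K where K: "\<And>z. \<bar>source n r u z\<bar> \<le> K" using taylor_source_bounded[OF assms] by blast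
  show ?thesis unfolding taylor_eq_series weighted_series_def
    by (rule suminf_mult[OF summable_weighted_series[OF \<rho>(3,4,2) K]])
qed

text \<open>The two series agree term by term. At index k + 1 the cell mass contributes k weights;
  one more comes from the integral, as the entry of the permuted first-level vector at the next
  digit.\<close>

lemma takagi_unit_eq:
  assumes d: "admissible q d" and r: "admissible q r" and x: "0 \<le> x" "x \<le> 1" and l: "l < q - 1"
  shows "takagi_unit q \<sigma> d r l x =
    completed q d (digit x) / real q * taylor (Suc 0) r (mi_unit l) (digit x, shift q x)"
proof -
  let ?z = "(digit x, shift q x)" and ?c = "completed q d (digit x)"
  let ?term = "\<lambda>k. ?c * ((\<Prod>i<k. weight r ((step ^^ i) ?z)) * source (Suc 0) r (mi_unit l) ((step ^^ k) ?z))"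
  have "(\<Sum>n<q ^ j. measure (multinomial_measure q \<sigma> d r) (I q j n) * indicat_real (I q j n) x *
        (LINT t:{0..(shift q ^^ j) x}|rescaled_measure q \<sigma> d r j n. Psi q \<sigma> r l t)) = ?term j" for j
  proof (cases j)
    \<comment> \<open>Nothing is rescaled at index 0, so here the entry at the first digit comes
      from \<open>d\<close> itself.\<close>
    case 0
    interpret prob_space "multinomial_measure q \<sigma> d r"
      using is_multinomial_multinomial_measure[OF d r] by (simp add: is_multinomial_def)
    have "I q 0 0 = space (multinomial_measure q \<sigma> d r)"
      using is_multinomial_multinomial_measure[OF d r] by (simp add: is_multinomial_def I_def)
    then have "measure (multinomial_measure q \<sigma> d r) (I q 0 0) = 1" using prob_space by simp
    moreover have "indicat_real (I q 0 0) x = 1" using x by (simp add: I_def)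
    ultimately show ?thesis
      unfolding 0 using integral_Psi[OF d r x l] by (simp add: rescaled_measure_def)
  next
    case (Suc k)
    let ?c' = "perm_vec q \<sigma> (cell (Suc k) x) r"
    have y: "0 \<le> (shift q ^^ Suc k) x" "(shift q ^^ Suc k) x \<le> 1"
      using shift_pow_bounds[OF x, of "Suc k"] by auto
    have "completed q ?c' (digit ((shift q ^^ Suc k) x)) = weight r ((step ^^ k) ?z)"
      using \<sigma>_power_mod[of "cell (Suc k) x"] cell_Suc_mod[OF x, of k]
      unfolding completed_perm_vec[OF digit_less] weight_def step_pow by simp
    moreover have "(digit ((shift q ^^ Suc k) x), shift q ((shift q ^^ Suc k) x)) = (step ^^ Suc k) ?z"
      unfolding step_pow by simp
    ultimately have
      i: "(LINT t:{0..(shift q ^^ Suc k) x}|rescaled_measure q \<sigma> d r (Suc k) (cell (Suc k) x). Psi q \<sigma>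
      r l t) =
        weight r ((step ^^ k) ?z) * source (Suc 0) r (mi_unit l) ((step ^^ Suc k) ?z)"
      using integral_Psi[OF admissible_perm_vec[OF r] r y l]
        by (simp only: rescaled_measure_def nat.simps if_False)
    show ?thesis
      unfolding Suc sum_indicator_I[OF x] i measure_I[OF d r cell_less] mass_cell[OF x] by simp
  qed
  then show ?thesis
    unfolding takagi_unit_def using suminf_weighted_source[OF r, of ?c ?z "Suc 0" "mi_unit l"] by simp
qed

section \<open>The recursion for Takagi functions of higher degree\<close>

lemma mi_degree_minus_unit_eq:
  assumes "a < q - 1" "0 < u a"
  shows "Suc (mi_degree q (mi_minus u (mi_unit a))) = mi_degree q u"
proof -
  have "mi_degree q (mi_minus u (mi_unit a)) = (u a - 1) + (\<Sum>l\<in>{..<q - 1} - {a}. u l)"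
    unfolding mi_degree_def using assms by (subst sum.remove[of _ a]) (auto simp: mi_minus_def mi_unit_def)
  moreover have "mi_degree q u = u a + (\<Sum>l\<in>{..<q - 1} - {a}. u l)"
    unfolding mi_degree_def using assms by (subst sum.remove[of _ a]) auto
  ultimately show ?thesis using assms by simp
qed

lemma mi_degree_1E:
  assumes "mi_degree q u = Suc 0"
  obtains l where "l < q - 1" "\<And>a. a < q - 1 \<Longrightarrow> u a = mi_unit l a"
proof -
  obtain l where l: "l < q - 1" "0 < u l" 
    using assms unfolding mi_degree_def by (metis lessThan_iff sum_SucD)
  have "mi_degree q (mi_minus u (mi_unit l)) = 0"
    using mi_degree_minus_unit_eq[of l u] l assms by simp
  then have *: "u a - mi_unit l a = 0" if "a < q - 1" for a
    using that by (simp add: mi_degree_def mi_minus_def)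
  show ?thesis
  proof (rule that[OF l(1)])
    fix a assume "a < q - 1"
    then show "u a = mi_unit l a" using *[of a] l(2) by (cases "a = l") (auto simp: mi_unit_def)
  qed
qed

text \<open>In the recursive step the denominator of Psi cancels the weight that the induction
  hypothesis yields as an entry of the permuted vector; this leaves \<open>dweight\<close> in place
  of that weight. The induction keeps \<open>d\<close> and \<open>x\<close> arbitrary because the
  recursion changes both.\<close>

theorem takagi_eq:
  assumes "admissible q d" "admissible q r" "0 \<le> x" "x \<le> 1" "mi_degree q u = Suc n"
  shows "takagi q \<sigma> d r u x = completed q d (digit x) / real q * taylor (Suc n) r u (digit x, shift q x)"
  using assms
proof (induction n arbitrary: d u x)
  case 0
  then obtain l where l: "l < q - 1" "\<And>a. a < q - 1 \<Longrightarrow> u a = mi_unit l a" by (auto elim: mi_degree_1E)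
  have "(THE l. l < q - 1 \<and> u l = 1) = l"
  proof (rule the_equality)
    show "l < q - 1 \<and> u l = 1" using l by (simp add: mi_unit_def)
    fix k assume k: "k < q - 1 \<and> u k = 1"
    then have "mi_unit l k = 1" using l(2)[of k] by simp
    then show "k = l" by (simp add: mi_unit_def split: if_split_asm)
  qed
  then have *: "takagi q \<sigma> d r u x = takagi_unit q \<sigma> d r l x"
    using 0 by (subst takagi.simps) simp
  have "taylor (Suc 0) r u = taylor (Suc 0) r (mi_unit l)" by (rule taylor_cong) (fact l(2))
  then show ?case unfolding * takagi_unit_eq[OF 0(1-4) l(1)] by (simp only:)
next
  case (Suc n)
  note r = Suc.prems(2) and x = Suc.prems(3,4)
  let ?z = "(digit x, shift q x)" and ?c = "completed q d (digit x) / real q"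
  let ?A = "{a. a < q - 1 \<and> 0 < u a}"
  have term_eq: "Psi q \<sigma> r a ((shift q ^^ j) x) *
        (\<Sum>m<q ^ (j + 1). measure (multinomial_measure q \<sigma> d r) (I q (j + 1) m) *
          indicat_real (I q (j + 1) m) x *
          takagi q \<sigma> (perm_vec q \<sigma> m r) r (mi_minus u (mi_unit a)) ((shift q ^^ (j + 1)) x)) =
      ?c * ((\<Prod>i<j. weight r ((step ^^ i) ?z)) *
        (dweight a ((step ^^ j) ?z) * taylor (Suc n) r (mi_minus u (mi_unit a)) (step ((step ^^ j) ?z))))"
    if a: "a \<in> ?A" for j a
  proof -
    let ?w = "weight r ((step ^^ j) ?z)"
    have y: "0 \<le> (shift q ^^ Suc j) x" "(shift q ^^ Suc j) x \<le> 1"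
      using shift_pow_bounds[OF x, of "Suc j"] by auto
    have y': "0 \<le> (shift q ^^ j) x" "(shift q ^^ j) x \<le> 1"
      using shift_pow_bounds[OF x, of j] by auto
    have deg: "mi_degree q (mi_minus u (mi_unit a)) = Suc n"
      using mi_degree_minus_unit_eq[of a u] a Suc.prems(5) by simp
    have al: "a < q - 1" using a by simp
    have "completed q (perm_vec q \<sigma> (cell (Suc j) x) r) (digit ((shift q ^^ Suc j) x)) = ?w"
      using \<sigma>_power_mod[of "cell (Suc j) x"] cell_Suc_mod[OF x, of j]
      unfolding completed_perm_vec[OF digit_less] weight_def step_pow by simp
    moreover have "(digit ((shift q ^^ Suc j) x), shift q ((shift q ^^ Suc j) x)) = step ((step ^^ j) ?z)"
      unfolding step_pow by (simp add: step_def)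
    ultimately have
      t: "takagi q \<sigma> (perm_vec q \<sigma> (cell (Suc j) x) r) r (mi_minus u (mi_unit a)) ((shift q ^^ Suc j) x) =
        ?w / real q * taylor (Suc n) r (mi_minus u (mi_unit a)) (step ((step ^^ j) ?z))"
      using Suc.IH[OF admissible_perm_vec[OF r] r y deg] by (simp only:)
    have p: "Psi q \<sigma> r a ((shift q ^^ j) x) = dweight a ((step ^^ j) ?z) / ?w"
      unfolding Psi_eq[OF y' al] step_pow by simp
    show ?thesis
      unfolding Suc_eq_plus1[symmetric] sum_indicator_I[OF x] measure_I[OF Suc.prems(1) r cell_less]
        mass_cell[OF x] t p
      using weight_pos[OF r, of "(step ^^ j) ?z"] by (simp add: field_simps)
  qed
  have "takagi q \<sigma> d r u x = (\<Sum>j. \<Sum>a\<in>?A.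
        Psi q \<sigma> r a ((shift q ^^ j) x) *
        (\<Sum>m<q ^ (j + 1). measure (multinomial_measure q \<sigma> d r) (I q (j + 1) m) *
          indicat_real (I q (j + 1) m) x *
          takagi q \<sigma> (perm_vec q \<sigma> m r) r (mi_minus u (mi_unit a)) ((shift q ^^ (j + 1)) x)))"
    using Suc.prems(5) by (subst takagi.simps) simp
  also have "\<dots> = (\<Sum>j. ?c * ((\<Prod>i<j. weight r ((step ^^ i) ?z)) * source (Suc (Suc n)) r u ((step ^^ j) ?z)))"
  proof -
    have src: "source (Suc (Suc n)) r u z =
        (\<Sum>a\<in>?A. dweight a z * taylor (Suc n) r (mi_minus u (mi_unit a)) (step z))" for z
      unfolding source_def nat.case by (simp only: nat.simps if_False add_0)
    then show ?thesis
      by (simp only: src term_eq sum_distrib_left[symmetric] cong: sum.cong)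
  qed
  also have "\<dots> = ?c * taylor (Suc (Suc n)) r u ?z" by (rule suminf_weighted_source[OF r])
  finally show ?case .
qed


subsection \<open>Differentiation in the parameters\<close>

text \<open>In the source for u + e_l, the term with a = l is the derivative of the weight times the
  coefficient of u. \<open>uniform_deriv_fixed_point\<close> handles that derivative separately, so
  one copy of the term is subtracted.\<close>

lemma uniform_deriv_source:
  fixes u :: "nat \<Rightarrow> nat" and l :: nat
  defines "u' \<equiv> u(l := Suc (u l))"
  assumes r: "admissible q r" and l: "l < q - 1" and deg: "mi_degree q u = n"
    and IH: "\<And>m v. n = Suc m \<Longrightarrow> mi_degree q v = m \<Longrightarrow>
      uniform_deriv (\<lambda>t. taylor m (r(l := r l + t)) v)
        (\<lambda>z. real (Suc (v l)) * taylor (Suc m) r (v(l := Suc (v l))) z)"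
  shows "uniform_deriv (\<lambda>t. source n (r(l := r l + t)) u)
    (\<lambda>z. real (Suc (u l)) * source (Suc n) r u' z - dweight l z * taylor n r u (step z))"
proof (cases n)
  case 0
  have u0: "u a = 0" if "a < q - 1" for a using deg 0 that by (simp add: mi_degree_def)
  have "source (Suc 0) r u' z = dbase l z + dweight l z * taylor 0 r u (step z)" for z
    by (rule source_mi_unit[OF l]) (auto simp: u'_def u0 l mi_unit_def)
  then have "real (Suc (u l)) * source (Suc 0) r u' z - dweight l z * taylor 0 r u (step z) =
    dbase l z" for z
    using u0[OF l] by simp
  moreover have "uniform_deriv (\<lambda>t. source 0 (r(l := r l + t)) u) (dbase l)"
    by (rule uniform_deriv_affine) (simp add: source_def base_upd[OF l])
  ultimately show ?thesis unfolding 0 by (simp only:)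
next
  case (Suc m)
  let ?A = "{a. a < q - 1 \<and> 0 < u a}"
  let ?g = "\<lambda>a z. dweight a z * taylor n r (mi_minus u' (mi_unit a)) (step z)"
  let ?c = "\<lambda>z. if m = 0 then \<Sum>a<q - 1. real (u a) * dbase a z else 0"
  have deriv_a: "uniform_deriv (\<lambda>t z. dweight a z * taylor m (r(l := r l +
    t)) (mi_minus u (mi_unit a)) (step z))
      (\<lambda>z. (if a = l then real (u l) else real (Suc (u l))) * ?g a z)" if a: "a \<in> ?A" for a
  proof -
    let ?v = "mi_minus u (mi_unit a)"
    have "mi_degree q ?v = m" using mi_degree_minus_unit_eq[of a u] a deg Suc by simp
    then have "uniform_deriv (\<lambda>t. taylor m (r(l := r l + t)) ?v)
        (\<lambda>z. real (Suc (?v l)) * taylor (Suc m) r (?v(l := Suc (?v l))) z)" by (rule IH[OF Suc])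
    \<comment> \<open>Lowering at \<open>a\<close> and raising at \<open>l\<close> commute because
      \<open>u a\<close> is positive. For a = l the factor is only \<open>u l\<close>, since one
      unit was removed before differentiating.\<close>
    moreover have "?v(l := Suc (?v l)) = mi_minus u' (mi_unit a)"
      using a by (auto simp: mi_minus_def mi_unit_def u'_def)
    moreover have "real (Suc (?v l)) = (if a = l then real (u l) else real (Suc (u l)))"
      using a by (auto simp: mi_minus_def mi_unit_def)
    ultimately have "uniform_deriv (\<lambda>t. taylor m (r(l := r l + t)) ?v)
        (\<lambda>z. (if a = l then real (u l) else real (Suc (u l))) * taylor n r (mi_minus u' (mi_unit a)) z)"
      using Suc by (simp only:)
    from uniform_deriv_mult_compose[OF this, of "dweight a" step] show ?thesis
      by (simp add: abs_dweight_le mult.left_commute)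
  qed
  have const: "uniform_deriv (\<lambda>t. ?c) (\<lambda>z. 0)" by (rule uniform_deriv_affine) simp
  have "uniform_deriv (\<lambda>t z. ?c z +
        (\<Sum>a\<in>?A. dweight a z * taylor m (r(l := r l + t)) (mi_minus u (mi_unit a)) (step z)))
      (\<lambda>z. 0 + (\<Sum>a\<in>?A. (if a = l then real (u l) else real (Suc (u l))) * ?g a z))"
    by (intro uniform_deriv_add[OF const] uniform_deriv_sum deriv_a) auto
  moreover have "0 + (\<Sum>a\<in>?A. (if a = l then real (u l) else real (Suc (u l))) * ?g a z) =
      real (Suc (u l)) * source (Suc n) r u' z - dweight l z * taylor n r u (step z)" for z
  proof -
    have A': "{a. a < q - 1 \<and> 0 < u' a} = insert l (?A - {l})" using l by (auto simp: u'_def)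
    have gl: "?g l z = dweight l z * taylor n r u (step z)"
    proof -
      have "mi_minus u' (mi_unit l) = u" by (auto simp: mi_minus_def mi_unit_def u'_def)
      then show ?thesis by simp
    qed
    have src: "source (Suc n) r u' z = ?g l z + (\<Sum>a\<in>?A - {l}. ?g a z)"
      unfolding source_def nat.case A' using Suc by (subst sum.insert) auto
    have "(\<Sum>a\<in>?A. (if a = l then real (u l) else real (Suc (u l))) * ?g a z) =
        real (u l) * ?g l z + real (Suc (u l)) * (\<Sum>a\<in>?A - {l}. ?g a z)"
    proof (cases "l \<in> ?A")
      case True
      then have "(\<Sum>a\<in>?A. (if a = l then real (u l) else real (Suc (u l))) * ?g a z) =
        real (u l) * ?g l z + (\<Sum>a\<in>?A - {l}. (if a = l then real (u l) else real (Suc (u l))) * ?g a z)"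
        by (subst sum.remove[of _ l]) auto
      also have "(\<Sum>a\<in>?A - {l}. (if a = l then real (u l) else real (Suc (u l))) * ?g a z) =
          (\<Sum>a\<in>?A - {l}. real (Suc (u l)) * ?g a z)" by (intro sum.cong) auto
      finally show ?thesis by (simp only: sum_distrib_left)
    next
      case False
      then have "u l = 0" using l by simp
      moreover have "(\<Sum>a\<in>?A. (if a = l then real (u l) else real (Suc (u l))) * ?g a z) =
          (\<Sum>a\<in>?A. real (Suc (u l)) * ?g a z)" using False by (intro sum.cong) auto
      moreover have "?A - {l} = ?A" using False by auto
      ultimately show ?thesis by (simp only: sum_distrib_left of_nat_0 mult_zero_left add_0)
    qed
    then show ?thesis unfolding src gl[symmetric] by (simp only: of_nat_Suc) (simp add: algebra_simps)
  qed
  ultimately show ?thesis unfolding Suc source_def[of "Suc m"] nat.case by (simp only:)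
qed

lemma uniform_deriv_taylor:
  assumes r: "admissible q r" and l: "l < q - 1" and deg: "mi_degree q u = n"
  shows "uniform_deriv (\<lambda>t. taylor n (r(l := r l + t)) u)
    (\<lambda>z. real (Suc (u l)) * taylor (Suc n) r (u(l := Suc (u l))) z)"
  using deg
proof (induction n arbitrary: u rule: less_induct)
  case (less n)
  let ?u' = "u(l := Suc (u l))"
  obtain \<delta> where \<delta>: "0 < \<delta>" "\<And>t. \<bar>t - r l\<bar> < \<delta> \<Longrightarrow> admissible q (r(l := t))"
    by (rule admissible_upd[OF r l]) blast
  have adm: "admissible q (r(l := r l + t))" if "\<bar>t\<bar> < \<delta>" for t using \<delta>(2)[of "r l + t"] that by simp
  obtain \<rho> where \<rho>: "0 < \<rho>" "\<rho> < 1" "\<And>z. 0 \<le> weight r z" "\<And>z. weight r z \<le> \<rho>"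
    by (rule weight_bound[OF r]) blast
  obtain C where C: "\<And>z. \<bar>taylor (Suc n) r ?u' z\<bar> \<le> C" using taylor_bounded[OF r] by blast
  have r0: "r(l := r l + 0) = r" by simp
  show ?case
  proof (rule uniform_deriv_fixed_point[where w = "weight r" and w' = "dweight l" and T = step and \<rho> = \<rho>
        and S = "\<lambda>t. source n (r(l := r l + t)) u"
        and S' = "\<lambda>z. real (Suc (u l)) * source (Suc n) r ?u' z - dweight l z * taylor n r u (step z)"
        and C = "real (Suc (u l)) * C"])
    show "0 < \<delta>" by fact
    show "taylor n (r(l := r l + t)) u z = source n (r(l := r l + t)) u z +
        (weight r z + t * dweight l z) * taylor n (r(l := r l + t)) u (step z)" if "\<bar>t\<bar> < \<delta>" for t z
      using taylor_eq[OF adm[OF that], of n u z] unfolding weight_upd[OF l] by simp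
    show "\<exists>C. \<forall>z. \<bar>taylor n (r(l := r l + t)) u z\<bar> \<le> C" if "\<bar>t\<bar> < \<delta>" for t
      by (rule taylor_bounded[OF adm[OF that]])
    show "real (Suc (u l)) * taylor (Suc n) r ?u' z =
        real (Suc (u l)) * source (Suc n) r ?u' z - dweight l z * taylor n r u (step z) +
        dweight l z * taylor n (r(l := r l + 0)) u (step z) +
        weight r z * (real (Suc (u l)) * taylor (Suc n) r ?u' (step z))" for z
      unfolding r0 taylor_eq[OF r, of "Suc n" ?u' z]
        by (simp only: ring_distribs) (simp only: mult.left_commute diff_add_cancel)
    show "\<bar>real (Suc (u l)) * taylor (Suc n) r ?u' z\<bar> \<le> real (Suc (u l)) * C" for z
      unfolding abs_mult abs_of_nat by (rule mult_left_mono[OF C]) (rule of_nat_0_le_iff)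
    show "\<bar>weight r z\<bar> \<le> \<rho>" for z using \<rho>(3,4)[of z] by simp
    show "uniform_deriv (\<lambda>t. source n (r(l := r l + t)) u)
      (\<lambda>z. real (Suc (u l)) * source (Suc n) r ?u' z - dweight l z * taylor n r u (step z))"
      by (rule uniform_deriv_source[OF r l less.prems less.IH]) simp_all
  qed (fact \<rho>(2) abs_dweight_le)+
qed

lemma uniform_deriv_imp_has_field_derivative:
  fixes g :: "real \<Rightarrow> 'a \<Rightarrow> real"
  assumes "uniform_deriv (\<lambda>t. g (c + t)) g'"
  shows "((\<lambda>t. g t z) has_field_derivative g' z) (at c)"
  unfolding DERIV_def LIM_def
proof (intro allI impI)
  fix \<epsilon> :: real assume "0 < \<epsilon>"
  then obtain \<delta> where \<delta>: "0 < \<delta>" "\<And>t z. \<bar>t\<bar> < \<delta> \<Longrightarrow> \<bar>g (c + t) z - g (c + 0) z - t * g' z\<bar> \<le> \<epsilon> / 2 * \<bar>t\<bar>"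
    using assms unfolding uniform_deriv_def by (meson half_gt_zero)
  have "dist ((g (c + t) z - g c z) / t) (g' z) < \<epsilon>" if t: "t \<noteq> 0" "dist t 0 < \<delta>" for t
  proof -
    have "(g (c + t) z - g c z) / t - g' z = (g (c + t) z - g (c + 0) z - t * g' z) / t"
      using t(1) by (simp add: diff_divide_distrib)
    then have "dist ((g (c + t) z - g c z) / t) (g' z) = \<bar>g (c + t) z - g (c + 0) z - t * g' z\<bar> / \<bar>t\<bar>"
      unfolding dist_real_def by (simp only: abs_divide)
    also have "\<dots> \<le> \<epsilon> / 2" using \<delta>(2)[of t z] t by (simp add: divide_le_eq)
    finally show ?thesis using \<open>0 < \<epsilon>\<close> by linarith
  qed
  then show "\<exists>\<delta>>0. \<forall>t. t \<noteq> 0 \<and> dist t 0 < \<delta> \<longrightarrow> dist ((g (c + t) z - g c z) / t) (g' z) < \<epsilon>"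
    using \<delta>(1) by blast
qed

lemma taylor_has_field_derivative:
  assumes "admissible q r" "l < q - 1" "mi_degree q u = n"
  shows "((\<lambda>t. taylor n (r(l := t)) u z) has_field_derivative
    real (Suc (u l)) * taylor (Suc n) r (u(l := Suc (u l))) z) (at (r l))"
  by (rule uniform_deriv_imp_has_field_derivative[OF uniform_deriv_taylor[OF assms]])

text \<open>With equal vectors the first level is no exception: state 0 carries the identity
  permutation, so the first digit obeys the transfer equation as well.\<close>

lemma L_diagonal:
  assumes "admissible q r" "0 \<le> x" "x \<le> 1"
  shows "L q \<sigma> r r x = taylor 0 r u (0, x)"
proof -
  have "L q \<sigma> r r x = distr_fun r r x" using L_eq_distr_fun[OF assms(1,1)] assms by simp
  also have "\<dots> = base r (0, x) + weight r (0, x) * taylor 0 r u (step (0, x))"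
    by (simp add: distr_fun_def base_def weight_def step_def)
  also have "\<dots> = taylor 0 r u (0, x)" using taylor_eq[OF assms(1), of 0 u "(0, x)"]
    by (simp only: source_def nat.case)
  finally show ?thesis .
qed

text \<open>The formula is kept for all admissible vectors because the next derivative needs it in a
  neighbourhood. The factors u_l + 1 collected along the list multiply up to the factorial.\<close>

lemma iterated_partial_L:
  assumes "set ls \<subseteq> {..<q - 1}" "0 \<le> x" "x \<le> 1"
  shows "(\<forall>s. admissible q s \<longrightarrow> iterated_partial ls (\<lambda>s. L q \<sigma> s s x) s =
      real (mi_fact q (count_list ls)) * taylor (length ls) s (count_list ls) (0, x)) \<and>
    iterated_partial_exists {s. admissible q s} ls (\<lambda>s. L q \<sigma> s s x)"
  using assms(1)
proof (induction ls)
  case Nil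
  then show ?case using L_diagonal[OF _ assms(2,3)] by (simp add: mi_fact_def del: taylor.simps)
next
  case (Cons l ls)
  let ?F = "\<lambda>s. L q \<sigma> s s x" and ?u = "count_list ls"
  let ?D = "\<lambda>s. real (mi_fact q ?u) * (real (Suc (?u l)) *
    taylor (Suc (length ls)) s (?u(l := Suc (?u l))) (0, x))"
  have l: "l < q - 1" and ls: "set ls \<subseteq> {..<q - 1}" using Cons.prems by auto
  have deg: "mi_degree q ?u = length ls" unfolding mi_degree_def by (rule sum_count_set[OF ls]) simp
  have deriv: "((\<lambda>t. iterated_partial ls ?F (s(l := t))) has_field_derivative ?D s) (at (s l))"
    if s: "admissible q s" for s
  proof -
    obtain \<delta> where \<delta>: "0 < \<delta>" "\<And>t. \<bar>t - s l\<bar> < \<delta> \<Longrightarrow> admissible q (s(l := t))"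
      by (rule admissible_upd[OF s l]) blast
    have "((\<lambda>t. real (mi_fact q ?u) *
      taylor (length ls) (s(l := t)) ?u (0, x)) has_field_derivative ?D s) (at (s l))"
      by (rule DERIV_cmult[OF taylor_has_field_derivative[OF s l deg]])
    then show ?thesis
    \<comment> \<open>The induction hypothesis speaks of admissible vectors only, so the two
      functions of t are known to agree just near \<open>s l\<close>.\<close>
    proof (rule has_field_derivative_transform_within[OF _ \<delta>(1)])
      show "real (mi_fact q ?u) * taylor (length ls) (s(l := t)) ?u (0, x) =
        iterated_partial ls ?F (s(l := t))"
        if "dist t (s l) < \<delta>" for t
        using conjunct1[OF Cons.IH[OF ls]] \<delta>(2)[of t] that unfolding dist_real_def by metis
    qed simp
  qed
  have upd: "?u(l := Suc (?u l)) = count_list (l # ls)" by auto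
  have "mi_fact q (count_list (l # ls)) = mi_fact q ?u * Suc (?u l)"
  proof -
    have "mi_fact q (count_list (l # ls)) = fact (Suc (?u l)) * (\<Prod>a\<in>{..<q - 1} - {l}. fact (?u a))"
      unfolding mi_fact_def using l by (subst prod.remove[of _ l]) (auto intro!: prod.cong)
    moreover have "mi_fact q ?u = fact (?u l) * (\<Prod>a\<in>{..<q - 1} - {l}. fact (?u a))"
      unfolding mi_fact_def using l by (subst prod.remove[of _ l]) auto
    ultimately show ?thesis by (simp add: algebra_simps)
  qed
  then have D: "?D s = real (mi_fact q (count_list (l # ls))) *
    taylor (length (l # ls)) s (count_list (l # ls)) (0, x)" for s
    unfolding upd by (simp only: of_nat_mult list.size mult.assoc add_Suc_right add_0_right)
  show ?case
  proof (intro conjI allI impI)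
    fix s assume "admissible q s"
    from DERIV_imp_deriv[OF deriv[OF this]] show "iterated_partial (l # ls) ?F s =
        real (mi_fact q (count_list (l # ls))) * taylor (length (l # ls)) s (count_list (l # ls)) (0, x)"
      unfolding iterated_partial.simps partial_deriv_def D .
  next
    show "iterated_partial_exists {s. admissible q s} (l # ls) ?F"
      using Cons.IH[OF ls] deriv by (auto simp: field_differentiable_def)
  qed
qed

section \<open>Multi-indices written as lists of variables\<close>

lemma count_list_mi_list: "a < q - 1 \<Longrightarrow> count_list (mi_list q u) a = u a"
  and set_mi_list: "set (mi_list q u) \<subseteq> {..<q - 1}"
  and length_mi_list: "length (mi_list q u) = mi_degree q u"
proof -
  have "count_list (replicate m b) a = (if a = b then m else 0)" for m b
    by (induction m) auto
  then have *: "count_list (concat (map (\<lambda>l. replicate (u l) l) [0..<n])) a =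
    (if a < n then u a else 0)" for n
    by (induction n) (auto simp: less_Suc_eq)
  show "a < q - 1 \<Longrightarrow> count_list (mi_list q u) a = u a" unfolding mi_list_def * by simp
  show "set (mi_list q u) \<subseteq> {..<q - 1}" by (auto simp: mi_list_def)
  have "length (concat (map (\<lambda>l. replicate (u l) l) [0..<n])) = (\<Sum>l<n. u l)" for n
    by (induction n) auto
  then show "length (mi_list q u) = mi_degree q u" unfolding mi_list_def mi_degree_def .
qed


subsection \<open>The derivative formulas\<close>

text \<open>For a uniform first level every first-level cell has mass 1 / q, and
  \<open>distr_fun\<close> can be solved for its coefficient of degree zero.\<close>

lemma taylor_0_uniform:
  assumes r: "admissible q r" and x: "0 \<le> x" "x \<le> 1"
  shows "taylor 0 r u (digit x, shift q x) = real q * L q \<sigma> (uniform_vec q) r x - real (digit x)"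
proof -
  have "L q \<sigma> (uniform_vec q) r x = distr_fun (uniform_vec q) r x"
    using L_eq_distr_fun[OF admissible_uniform_vec r] x by simp
  also have "\<dots> = real (digit x) / real q + 1 / real q * taylor 0 r u (digit x, shift q x)"
  proof -
    have "(\<Sum>m<digit x. completed q (uniform_vec q) m) = (\<Sum>m<digit x. 1 / real q)"
      using less_trans[OF _ digit_less] by (intro sum.cong completed_uniform_vec) auto
    then show ?thesis by (simp add: distr_fun_def completed_uniform_vec)
  qed
  finally show ?thesis by (simp add: field_simps del: taylor.simps)
qed

text \<open>One factor q cancels the mass 1 / q of the first-level cell, the other the 1 / q in
  \<open>takagi_unit\<close>, which the recursion hands on to higher degrees.\<close>

lemma takagi_uniform:
  assumes "admissible q r" "0 \<le> x" "x \<le> 1" "mi_degree q u = Suc n"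
  shows "real q * (real q * takagi q \<sigma> (uniform_vec q) r u x) = taylor (Suc n) r u (digit x, shift q x)"
  using takagi_eq[OF admissible_uniform_vec assms] by (simp add: completed_uniform_vec del: taylor.simps)

lemma sum_indicator_I1:
  assumes "0 \<le> x" "x \<le> 1"
  shows "(\<Sum>n<q. f n * indicat_real (I q 1 n) x) = f (digit x)"
  using sum_indicator_I[OF assms, where g = f and k = 1 and f = "\<lambda>_. 1"] by (simp add: digit_def)

lemma dcompleted_digit:
  assumes "0 \<le> x" "x \<le> 1" "l < q - 1"
  shows "dcompleted l (digit x) = indicat_real (I q 1 l) x - indicat_real (I q 1 (q - 1)) x"
proof -
  have "l < q" "q - 1 < q" "l \<noteq> q - 1" using assms(3) by auto
  then show ?thesis using indicator_I1[OF assms(1,2)] by (auto simp: dcompleted_def)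
qed

lemma measure_lborel_Icc_Int_I1:
  assumes x: "0 \<le> x" "x \<le> 1" and n: "n < q"
  shows "measure lborel ({0..x} \<inter> I q 1 n) =
    (if n < digit x then 1 / real q else if n = digit x then x - real n / real q else 0)"
proof -
  let ?a = "real n / real q" and ?b = "real (n + 1) / real q"
  have a: "0 \<le> ?a" "?a \<le> ?b" by (auto simp: divide_simps)
  have xd: "real (digit x) / real q \<le> x" "x \<le> real (digit x + 1) / real q"
    using cell_le[OF x, of 1] le_cell[OF x, of 1] by (auto simp: digit_def field_simps)
  consider "n < digit x" | "n = digit x" | "digit x < n" by linarith
  then show ?thesis
  proof cases
    case 1
    then have "real (n + 1) \<le> real (digit x)" by (intro of_nat_mono) simp
    then have "?b \<le> real (digit x) / real q" by (intro divide_right_mono) auto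
    then have "?b \<le> x" using xd by linarith
    moreover have "n \<noteq> q - 1" using 1 digit_less[of x] by linarith
    ultimately have "{0..x} \<inter> I q 1 n = {?a..<?b}"
      using a by (auto simp: I_def intro: order_trans[OF a(1)])
    then show ?thesis using 1 a by (simp add: diff_divide_distrib[symmetric])
  next
    case 2
    show ?thesis
    proof (cases "x \<in> {?a..<?b} \<or> n = q - 1")
      case True
      then have "{0..x} \<inter> I q 1 n = {?a..x}" using a x by (auto simp: I_def intro: order_trans[OF a(1)])
      then show ?thesis using 2 xd by simp
    next
      case False
      \<comment> \<open>A contradictory case: x always lies in its own cell.\<close>
      then show ?thesis using mem_I_cell[OF x, of 1] 2 by (auto simp: I_def digit_def)
    qed
  next
    case 3
    have "{0..x} \<inter> I q 1 n = {}"
    proof (rule ccontr)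
      assume "{0..x} \<inter> I q 1 n \<noteq> {}"
      then obtain t where t: "0 \<le> t" "t \<le> x" "t \<in> I q 1 n" by auto
      then have "cell 1 t = n" using mem_I_iff_cell[of t n 1] x n by simp
      then show False using cell_mono[OF t(2), of 1] 3 by (simp add: digit_def)
    qed
    then show ?thesis using 3 by simp
  qed
qed

text \<open>The transfer equation compares \<open>L\<close> with the grid point
  \<open>real (digit x) / real q\<close>; adding and subtracting this integral makes the comparison
  with x itself and absorbs \<open>dbase\<close>.\<close>

lemma integral_indicator_I1:
  assumes x: "0 \<le> x" "x \<le> 1" and l: "l < q - 1"
  shows "(LINT t:{0..x}|lborel. indicat_real (I q 1 l) t - indicat_real (I q 1 (q - 1)) t) =
    dbase l (0, x) / real q + dcompleted l (digit x) * (x - real (digit x) / real q)"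
proof -
  have fin: "emeasure lborel ({0..x} \<inter> I q 1 n) < \<infinity>" for n
    by (rule le_less_trans[OF emeasure_mono[of _ "{0..x}"]]) (use x in auto)
  have sets: "{0..x} \<inter> I q 1 n \<in> sets lborel" for n by (simp add: I_def)
  have "(LINT t:{0..x}|lborel. indicat_real (I q 1 l) t - indicat_real (I q 1 (q - 1)) t) =
      (\<integral>t. indicat_real ({0..x} \<inter> I q 1 l) t - indicat_real ({0..x} \<inter> I q 1 (q - 1)) t \<partial>lborel)"
    unfolding set_lebesgue_integral_def
    by (intro Bochner_Integration.integral_cong) (auto simp: indicator_def)
  also have "\<dots> = measure lborel ({0..x} \<inter> I q 1 l) - measure lborel ({0..x} \<inter> I q 1 (q - 1))"
    by (subst Bochner_Integration.integral_diff) (use fin sets in \<open>auto intro!: integrable_real_indicator\<close>)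
  finally have int: "(LINT t:{0..x}|lborel. indicat_real (I q 1 l) t - indicat_real (I q 1 (q - 1)) t) =
      measure lborel ({0..x} \<inter> I q 1 l) - measure lborel ({0..x} \<inter> I q 1 (q - 1))" .
  have "dbase l (0, x) = (\<Sum>m<digit x. if m = l then 1 else 0)"
    unfolding dbase_def
  proof (rule sum.cong)
    fix m assume "m \<in> {..<digit x}"
    \<comment> \<open>To the left of a digit the last entry never occurs, so the value -1 of
      \<open>dcompleted\<close> is absent.\<close>
    then have "m \<noteq> q - 1" using digit_less[of x] unfolding lessThan_iff by linarith
    then show "dcompleted l ((\<sigma> ^^ fst (0::nat, x)) m) = (if m = l then 1 else 0)"
      by (simp add: dcompleted_def)
  qed simp
  then have db: "dbase l (0, x) = (if l < digit x then 1 else 0)" by simp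
  have lq: "l < q" "q - 1 < q" "l \<noteq> q - 1" using l by auto
  show ?thesis
    unfolding int measure_lborel_Icc_Int_I1[OF x lq(1)] measure_lborel_Icc_Int_I1[OF x lq(2)] db
      dcompleted_def
    using lq by (auto; use digit_less[of x] in linarith)
qed

text \<open>One step from (0, x) leads to the state at which \<open>takagi_eq\<close> evaluates the
  coefficients, and at state 0 \<open>dweight\<close> is the difference of indicators.\<close>

lemma sum_dweight_taylor:
  assumes "admissible q r" "0 \<le> x" "x \<le> 1" "mi_degree q u = Suc (Suc n)"
  shows "(\<Sum>a | a < q - 1 \<and> 0 < u a. dweight a (0, x) *
    taylor (Suc n) r (mi_minus u (mi_unit a)) (step (0, x))) =
    real q * (\<Sum>j\<in>{j. j < q - 1 \<and> 0 < u j}.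
      (indicat_real (I q 1 j) x - indicat_real (I q 1 (q - 1)) x) *
      (real q * takagi q \<sigma> (uniform_vec q) r (mi_minus u (mi_unit j)) x))"
  unfolding sum_distrib_left
proof (rule sum.cong[OF refl])
  fix a assume a: "a \<in> {a. a < q - 1 \<and> 0 < u a}"
  then have "mi_degree q (mi_minus u (mi_unit a)) = Suc n"
    using mi_degree_minus_unit_eq[of a u] assms(4) by simp
  from takagi_uniform[OF assms(1-3) this]
  show "dweight a (0, x) * taylor (Suc n) r (mi_minus u (mi_unit a)) (step (0, x)) =
      real q * ((indicat_real (I q 1 a) x - indicat_real (I q 1 (q - 1)) x) *
        (real q * takagi q \<sigma> (uniform_vec q) r (mi_minus u (mi_unit a)) x))"
    using a dcompleted_digit[OF assms(2,3), of a]
    by (simp add: dweight_def step_def del: taylor.simps)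
qed

lemma iterated_partial_mi_list:
  assumes "admissible q r" "0 \<le> x" "x \<le> 1"
  shows "iterated_partial (mi_list q u) (\<lambda>s. L q \<sigma> s s x) r =
    real (mi_fact q u) * taylor (mi_degree q u) r u (0, x)"
proof -
  have "taylor n r (count_list (mi_list q u)) = taylor n r u" for n
    by (rule taylor_cong) (rule count_list_mi_list)
  moreover have "mi_fact q (count_list (mi_list q u)) = mi_fact q u"
    unfolding mi_fact_def by (intro prod.cong) (auto simp: count_list_mi_list)
  ultimately show ?thesis
    using iterated_partial_L[OF set_mi_list assms(2,3), of u] assms(1) by (simp only: length_mi_list)
qed

lemma mi_fact_pos: "0 < mi_fact q u"
  unfolding mi_fact_def by (intro prod_pos) simp

lemma higher_derivative_formula:
  assumes r: "admissible q r" and x: "0 \<le> x" "x \<le> 1" and deg: "2 \<le> mi_degree q u"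
  shows "1 / (real q * real (mi_fact q u)) * iterated_partial (mi_list q u) (\<lambda>s. L q \<sigma> s s x) r =
    (\<Sum>j\<in>{j. j < q - 1 \<and> 0 < u j}.
      (indicat_real (I q 1 j) x - indicat_real (I q 1 (q - 1)) x) *
      (real q * takagi q \<sigma> (uniform_vec q) r (mi_minus u (mi_unit j)) x))
    + (\<Sum>n<q. completed q r n * indicat_real (I q 1 n) x) *
      (real q * takagi q \<sigma> (uniform_vec q) r u x)"
proof -
  define n where "n = mi_degree q u - 2"
  have n: "mi_degree q u = Suc (Suc n)" using deg by (simp add: n_def)
  let ?S = "\<Sum>j\<in>{j. j < q - 1 \<and> 0 < u j}. (indicat_real (I q 1 j) x - indicat_real (I q 1 (q - 1)) x) *
      (real q * takagi q \<sigma> (uniform_vec q) r (mi_minus u (mi_unit j)) x)"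
  let ?t = "real q * takagi q \<sigma> (uniform_vec q) r u x"
  \<comment> \<open>From degree two on, the affine \<open>base\<close> contributes nothing.\<close>
  have "source (Suc (Suc n)) r u (0, x) = real q * ?S"
    unfolding source_def nat.case using sum_dweight_taylor[OF r x n] by (simp only: nat.simps
      if_False add_0)
  moreover have "weight r (0, x) = completed q r (digit x)" by (simp add: weight_def)
  moreover have "taylor (Suc (Suc n)) r u (step (0, x)) = real q * ?t"
    using takagi_uniform[OF r x n] by (simp only: step_def snd_conv)
  ultimately have "taylor (mi_degree q u) r u (0, x) = real q * (?S + completed q r (digit x) * ?t)"
    using taylor_eq[OF r, of "Suc (Suc n)" u "(0, x)"] unfolding n
      by (simp only: distrib_left mult.left_commute)
  then show ?thesis
    unfolding iterated_partial_mi_list[OF r x] sum_indicator_I1[OF x] using mi_fact_pos[of u] by simp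
qed

lemma first_derivative_formula:
  assumes r: "admissible q r" and x: "0 \<le> x" "x \<le> 1" and l: "l < q - 1"
  shows "(\<lambda>t. L q \<sigma> (r(l := t)) (r(l := t)) x) field_differentiable (at (r l))"
    "1 / real q * partial_deriv l (\<lambda>s. L q \<sigma> s s x) r =
      (indicat_real (I q 1 l) x - indicat_real (I q 1 (q - 1)) x) * (L q \<sigma> (uniform_vec q) r x - x)
      + (\<Sum>n<q. completed q r n * indicat_real (I q 1 n) x) *
        (real q * takagi q \<sigma> (uniform_vec q) r (mi_unit l) x)
      + (LINT t:{0..x}|lborel. indicat_real (I q 1 l) t - indicat_real (I q 1 (q - 1)) t)"
proof -
  have "set [l] \<subseteq> {..<q - 1}" using l by simp
  note * = iterated_partial_L[OF this x]
  show "(\<lambda>t. L q \<sigma> (r(l := t)) (r(l := t)) x) field_differentiable (at (r l))"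
    using conjunct2[OF *] r by simp
  have u: "count_list [l] = mi_unit l" by (auto simp: mi_unit_def)
  have f: "mi_fact q (mi_unit l) = 1" unfolding mi_fact_def by (intro prod.neutral) (auto simp: mi_unit_def)
  have deg: "mi_degree q (mi_unit l) = Suc 0" using l by (simp add: mi_degree_def mi_unit_def sum.delta)
  let ?t = "real q * takagi q \<sigma> (uniform_vec q) r (mi_unit l) x"
  have "partial_deriv l (\<lambda>s. L q \<sigma> s s x) r = taylor (Suc 0) r (mi_unit l) (0, x)"
    using conjunct1[OF *] r unfolding u f by (simp del: taylor.simps)
  also have "\<dots> = source (Suc 0) r (mi_unit l) (0, x) + weight r (0, x) *
    taylor (Suc 0) r (mi_unit l) (step (0, x))"
    by (rule taylor_eq[OF r])
  \<comment> \<open>The lower coefficient has degree zero here: it comes from the distribution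
    function with uniform first level, not from a Takagi function.\<close>
  also have "source (Suc 0) r (mi_unit l) (0, x) =
      dbase l (0, x) + dcompleted l (digit x) * (real q * L q \<sigma> (uniform_vec q) r x - real (digit x))"
    unfolding source_mi_unit[OF l refl, of r _ "\<lambda>_. 0"] using taylor_0_uniform[OF r x]
    by (simp add: dweight_def step_def del: taylor.simps)
  also have "weight r (0, x) = completed q r (digit x)" by (simp add: weight_def)
  also have "taylor (Suc 0) r (mi_unit l) (step (0, x)) = real q * ?t"
    using takagi_uniform[OF r x deg] by (simp only: step_def snd_conv)
  finally have pd: "partial_deriv l (\<lambda>s. L q \<sigma> s s x) r =
      dbase l (0, x) + dcompleted l (digit x) * (real q * L q \<sigma> (uniform_vec q) r x - real (digit x))
      + completed q r (digit x) * (real q * ?t)" .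
  show "1 / real q * partial_deriv l (\<lambda>s. L q \<sigma> s s x) r =
      (indicat_real (I q 1 l) x - indicat_real (I q 1 (q - 1)) x) * (L q \<sigma> (uniform_vec q) r x - x)
      + (\<Sum>n<q. completed q r n * indicat_real (I q 1 n) x) *
        (real q * takagi q \<sigma> (uniform_vec q) r (mi_unit l) x)
      + (LINT t:{0..x}|lborel. indicat_real (I q 1 l) t - indicat_real (I q 1 (q - 1)) t)"
    unfolding pd sum_indicator_I1[OF x] integral_indicator_I1[OF x l] dcompleted_digit[OF x l, symmetric]
    by (simp add: field_simps)
qed

end

theorem theorem1:
  fixes q :: nat and \<sigma> :: "nat \<Rightarrow> nat" and r :: "nat \<Rightarrow> real" and x :: real
  assumes "2 \<le> q"
    and "\<sigma> permutes {..<q}"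
    and "\<sigma> ^^ q = id"
    and "admissible q r"
    and "x \<in> {0..1}"
  shows
    "(\<forall>u l. l < q - 1 \<and> u = mi_unit l \<longrightarrow>
        (\<lambda>t. L q \<sigma> (r(l := t)) (r(l := t)) x) field_differentiable (at (r l)) \<and>
        1 / real q * partial_deriv l (\<lambda>s. L q \<sigma> s s x) r =
          (indicat_real (I q 1 l) x - indicat_real (I q 1 (q - 1)) x) *
            (L q \<sigma> (uniform_vec q) r x - x)
          + (\<Sum>n<q. completed q r n * indicat_real (I q 1 n) x) *
            (real q * takagi q \<sigma> (uniform_vec q) r u x)
          + (LINT t:{0..x}|lborel. indicat_real (I q 1 l) t - indicat_real (I q 1 (q - 1)) t))
     \<and>
     (\<forall>u. 2 \<le> mi_degree q u \<longrightarrow>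
        iterated_partial_exists {s. admissible q s} (mi_list q u) (\<lambda>s. L q \<sigma> s s x) \<and>
        1 / (real q * real (mi_fact q u)) *
            iterated_partial (mi_list q u) (\<lambda>s. L q \<sigma> s s x) r =
          (\<Sum>j\<in>{j. j < q - 1 \<and> 0 < u j}.
             (indicat_real (I q 1 j) x - indicat_real (I q 1 (q - 1)) x) *
             (real q * takagi q \<sigma> (uniform_vec q) r (mi_minus u (mi_unit j)) x))
          + (\<Sum>n<q. completed q r n * indicat_real (I q 1 n) x) *
            (real q * takagi q \<sigma> (uniform_vec q) r u x))"
proof -
  interpret digit_system q \<sigma> by unfold_locales (fact assms)+
  have x: "0 \<le> x" "x \<le> 1" using assms(5) by auto
  show ?thesis
    using first_derivative_formula[OF assms(4) x] higher_derivative_formula[OF assms(4) x]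
      iterated_partial_L[OF set_mi_list x] by blast
qed

end
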